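(* Let $\lambda,\mu,\kappa\in\mathcal{P}_d$ with $\kappa_i\leq\mu_i$ for $i=1,\ldots,d$. Then $$s_\lambda(x\,|\,y)\,s_{\mu/\kappa}(x\,|\,y)=\sum_{B} c_{\lambda*B}\; s_{\lambda+\omega(B^u)}(x\,|\,y),$$ where the sum is over all $B\in\mathcal{B}(\mu/\kappa)$ such that $(\lambda*B)^u$ is Yamanouchi.
   Context: Fix a positive integer $d$; for an integer $m$, $m':=d+1-m$. $\mathbb{N}$ is the set of nonnegative integers. $\mathcal{P}_d$ is the set of partitions $\lambda=(\lambda_1\geq\cdots\geq\lambda_d)\in\mathbb{N}^d$. For a finite sequence with terms in $\{1,\ldots,d\}$, its content $\omega\in\mathbb{N}^d$ has $\omega_k$ equal to the number of $k$'s in the sequence. $x_1,\ldots,x_d$ and $(y_i)_{i\in\mathbb{Z}}$ are variables. The reverse Young diagram of $\mu$ is the right- and bottom-justified array of boxes whose bottom row has length $\mu_1$, next-to-bottom row length $\mu_2$, etc.; rows are numbered from bottom to top and columns from right to left, starting with $1$. The reverse skew diagram $\mu/\kappa$ consists of the boxes of $\mu$ in row $r$ and column $c$ with $\kappa_r<c\leq\mu_r$ (the boxes of $\kappa\subset\mu$ are regarded as empty; row and column numbers $r(a),c(a)$ of an entry $a$ are those in $\mu$). $\mathcal{R}(\mu/\kappa)$ is the set of fillings of $\mu/\kappa$ by elements of $\{1,\ldots,d\}$, weakly increasing along rows from left to right and strictly increasing down columns. $\mathcal{B}(\mu/\kappa)$ is the set of fillings of $\mu/\kappa$ by elements of $\{1,\ldots,d\}\cup\{\bar1,\ldots,\bar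 d\}$ whose values, disregarding bars, satisfy the same conditions. Define $s_{\mu/\kappa}(x\,|\,y)=\sum_{R\in\mathcal{R}(\mu/\kappa)}\prod_{a\in R}(x_a-y_{a'+c(a)-r(a)})$ and $s_\mu(x\,|\,y)=s_{\mu/\emptyset}(x\,|\,y)$, with $\emptyset=(0,\ldots,0)$. For $B\in\mathcal{B}(\mu/\kappa)$, $\lambda*B$ is obtained by placing the Young tableau of shape $\lambda$ (top-left justified) whose $i$-th row consists of $\lambda_i$ unbarred $i$'s above and to the right of $B$ (no shared rows or columns). The unbarred column words $(\lambda*B)^u$ and $B^u$ are the sequences of unbarred entries of $\lambda*B$, resp. $B$, read column by column from the rightmost column to the leftmost, each column from top to bottom, skipping barred entries and empty boxes. A word is Yamanouchi if every initial segment contains at least as many $k$'s as $(k+1)$'s, $k=1,\ldots,d-1$. For an entry $a$ of $B$, $|a|$ is its value (bar disregarded) and $(\lambda*B)^u_{<a}$ is the portion of $(\lambda*B)^u$ that comes before reaching $a$. Set $$c_{\lambda*B}=\prod_{a\in B,\ a\text{ barred}}\left(y_{|a|'+\omega((\lambda*B)^u_{<a})_{|a|}}-y_{|a|'+c(a)-r(a)}\right)$$ (empty product $=1$). *)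

theory Defs
  imports Complex_Main "HOL-Library.FuncSet"
begin

text \<open>Vectors in \<open>\<nat>\<^sup>d\<close> are functions \<open>nat \<Rightarrow> nat\<close> on the indices \<open>1, \<dots>, d\<close>, extended by zero.\<close>

definition partitions :: "nat \<Rightarrow> (nat \<Rightarrow> nat) set" where
  "partitions d = {lam. (\<forall>i. 1 \<le> i \<and> i < d \<longrightarrow> lam (Suc i) \<le> lam i) \<and>
                        (\<forall>i. i \<notin> {1..d} \<longrightarrow> lam i = 0)}"

definition empty_partition :: "nat \<Rightarrow> nat" where
  "empty_partition = (\<lambda>_. 0)"

definition content :: "nat list \<Rightarrow> nat \<Rightarrow> nat" where
  "content w = (\<lambda>k. count_list w k)"

text \<open>The involution \<open>m' = d + 1 - m\<close>.\<close>

definition dual_index :: "nat \<Rightarrow> int \<Rightarrow> int" where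
  "dual_index d m = int d + 1 - m"

text \<open>
  A box is a pair \<open>(r, c)\<close> of a row number and a column number. Rows are numbered from bottom to
  top and columns from right to left, so moving to the right decreases \<open>c\<close> and moving down
  decreases \<open>r\<close>.
\<close>

definition skew_diagram :: "nat \<Rightarrow> (nat \<Rightarrow> nat) \<Rightarrow> (nat \<Rightarrow> nat) \<Rightarrow> (nat \<times> nat) set" where
  "skew_diagram d mu kap = {(r, c). 1 \<le> r \<and> r \<le> d \<and> kap r < c \<and> c \<le> mu r}"

definition semistandard :: "(nat \<times> nat) set \<Rightarrow> (nat \<times> nat \<Rightarrow> nat) \<Rightarrow> bool" where
  "semistandard D T \<longleftrightarrow>
     (\<forall>r c c'. (r, c) \<in> D \<and> (r, c') \<in> D \<and> c < c' \<longrightarrow> T (r, c') \<le> T (r, c)) \<and>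
     (\<forall>r r' c. (r, c) \<in> D \<and> (r', c) \<in> D \<and> r < r' \<longrightarrow> T (r', c) < T (r, c))"

definition fillings :: "nat \<Rightarrow> (nat \<Rightarrow> nat) \<Rightarrow> (nat \<Rightarrow> nat) \<Rightarrow> (nat \<times> nat \<Rightarrow> nat) set" where
  "fillings d mu kap =
     {R \<in> skew_diagram d mu kap \<rightarrow>\<^sub>E {1..d}. semistandard (skew_diagram d mu kap) R}"

datatype entry = Unbarred (val: nat) | Barred (val: nat)

definition is_barred :: "entry \<Rightarrow> bool" where
  "is_barred e \<longleftrightarrow> e = Barred (val e)"

definition barred_fillings ::
  "nat \<Rightarrow> (nat \<Rightarrow> nat) \<Rightarrow> (nat \<Rightarrow> nat) \<Rightarrow> (nat \<times> nat \<Rightarrow> entry) set" where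
  "barred_fillings d mu kap =
     {B \<in> skew_diagram d mu kap \<rightarrow>\<^sub>E Unbarred ` {1..d} \<union> Barred ` {1..d}.
        semistandard (skew_diagram d mu kap) (\<lambda>b. val (B b))}"

definition skew_factorial_schur ::
  "nat \<Rightarrow> (nat \<Rightarrow> nat) \<Rightarrow> (nat \<Rightarrow> nat) \<Rightarrow> (nat \<Rightarrow> 'a) \<Rightarrow> (int \<Rightarrow> 'a) \<Rightarrow> 'a :: comm_ring_1" where
  "skew_factorial_schur d mu kap x y =
     (\<Sum>R \<in> fillings d mu kap.
        \<Prod>(r, c) \<in> skew_diagram d mu kap.
          x (R (r, c)) - y (dual_index d (int (R (r, c))) + int c - int r))"

definition factorial_schur ::
  "nat \<Rightarrow> (nat \<Rightarrow> nat) \<Rightarrow> (nat \<Rightarrow> 'a) \<Rightarrow> (int \<Rightarrow> 'a) \<Rightarrow> 'a :: comm_ring_1" where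
  "factorial_schur d mu x y = skew_factorial_schur d mu empty_partition x y"

text \<open>
  The boxes of \<open>\<mu>/\<kappa>\<close> column by column, from the rightmost column (\<open>c = 1\<close>) to the leftmost
  (\<open>c = \<mu>\<^sub>1\<close>), each column from top (large \<open>r\<close>) to bottom.
\<close>

definition reading_order :: "nat \<Rightarrow> (nat \<Rightarrow> nat) \<Rightarrow> (nat \<Rightarrow> nat) \<Rightarrow> (nat \<times> nat) list" where
  "reading_order d mu kap =
     concat (map (\<lambda>c. map (\<lambda>r. (r, c)) (filter (\<lambda>r. (r, c) \<in> skew_diagram d mu kap) (rev [1..<Suc d])))
               [1..<Suc (mu 1)])"

definition unbarred_entries :: "(nat \<times> nat \<Rightarrow> entry) \<Rightarrow> (nat \<times> nat) list \<Rightarrow> nat list" where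
  "unbarred_entries B bs = map (\<lambda>b. val (B b)) (filter (\<lambda>b. \<not> is_barred (B b)) bs)"

definition unbarred_word ::
  "nat \<Rightarrow> (nat \<Rightarrow> nat) \<Rightarrow> (nat \<Rightarrow> nat) \<Rightarrow> (nat \<times> nat \<Rightarrow> entry) \<Rightarrow> nat list" where
  "unbarred_word d mu kap B = unbarred_entries B (reading_order d mu kap)"

text \<open>
  Column word of the top-left justified tableau of shape \<open>\<lambda>\<close> whose \<open>i\<close>-th row consists of \<open>i\<close>'s.
  Here \<open>j\<close> counts columns from the left; column \<open>j\<close> meets exactly the rows \<open>i\<close> with \<open>j \<le> \<lambda>\<^sub>i\<close>.
\<close>

definition tableau_word :: "nat \<Rightarrow> (nat \<Rightarrow> nat) \<Rightarrow> nat list" where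
  "tableau_word d lam =
     concat (map (\<lambda>j. filter (\<lambda>i. j \<le> lam i) [1..<Suc d]) (rev [1..<Suc (lam 1)]))"

text \<open>
  In \<open>\<lambda> * B\<close> the tableau of shape \<open>\<lambda>\<close> lies strictly to the right of \<open>B\<close>, so it is read first.
\<close>

definition star_word ::
  "nat \<Rightarrow> (nat \<Rightarrow> nat) \<Rightarrow> (nat \<Rightarrow> nat) \<Rightarrow> (nat \<Rightarrow> nat) \<Rightarrow> (nat \<times> nat \<Rightarrow> entry) \<Rightarrow> nat list" where
  "star_word d lam mu kap B = tableau_word d lam @ unbarred_word d mu kap B"

text \<open>The portion of \<open>(\<lambda> * B)\<^sup>u\<close> that comes before reaching the entry of \<open>B\<close> in box \<open>b\<close>.\<close>

definition star_word_before ::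
  "nat \<Rightarrow> (nat \<Rightarrow> nat) \<Rightarrow> (nat \<Rightarrow> nat) \<Rightarrow> (nat \<Rightarrow> nat) \<Rightarrow> (nat \<times> nat \<Rightarrow> entry) \<Rightarrow> nat \<times> nat \<Rightarrow> nat list"
where
  "star_word_before d lam mu kap B b =
     tableau_word d lam @ unbarred_entries B (takeWhile (\<lambda>b'. b' \<noteq> b) (reading_order d mu kap))"

definition yamanouchi :: "nat \<Rightarrow> nat list \<Rightarrow> bool" where
  "yamanouchi d w \<longleftrightarrow>
     (\<forall>n \<le> length w. \<forall>k. 1 \<le> k \<and> k < d \<longrightarrow>
        content (take n w) (Suc k) \<le> content (take n w) k)"

definition star_coeff ::
  "nat \<Rightarrow> (nat \<Rightarrow> nat) \<Rightarrow> (nat \<Rightarrow> nat) \<Rightarrow> (nat \<Rightarrow> nat) \<Rightarrow> (nat \<times> nat \<Rightarrow> entry) \<Rightarrow> (int \<Rightarrow> 'a)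
     \<Rightarrow> 'a :: comm_ring_1" where
  "star_coeff d lam mu kap B y =
     (\<Prod>(r, c) \<in> {b \<in> skew_diagram d mu kap. is_barred (B b)}.
        let v = val (B (r, c)) in
          y (dual_index d (int v) + int (content (star_word_before d lam mu kap B (r, c)) v))
          - y (dual_index d (int v) + int c - int r))"

end

theory Submission
  imports "HOL-Combinatorics.Permutations" "HOL-Computational_Algebra.Polynomial" Defs
begin

text \<open>
  The proof follows Stembridge's short proof of the Littlewood-Richardson rule, in the form that
  Kreiman gave to it for factorial Schur functions. Let \<open>a\<^sub>\<lambda>\<close> be the alternating sum over the
  permutations of \<open>x\<close> of the factorial monomial
  \<open>\<Prod>\<^sub>i (x\<^sub>i - y\<^sub>1) \<dots> (x\<^sub>i - y\<^sub>m)\<close>, \<open>m = \<lambda>\<^sub>i + d - i\<close>.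

  Because the skew function \<open>s\<^sub>\<mu>\<^sub>/\<^sub>\<kappa>\<close> is symmetric, \<open>a\<^sub>\<lambda> s\<^sub>\<mu>\<^sub>/\<^sub>\<kappa>\<close> is the alternating sum of the monomial
  times the sum over all fillings. The weights are multiplied into the monomial column by column,
  from the right. A weight \<open>x\<^sub>a - y\<^sub>b\<close> equals \<open>(x\<^sub>a - y\<^sub>n) + (y\<^sub>n - y\<^sub>b)\<close>, where the first summand prolongs the
  monomial by one factor and the second is a scalar; recording the second choice by a bar turns the
  product into a sum over barred fillings with exactly the coefficients of the theorem
  (\<open>expand_column\<close>). As soon as a column violates the Yamanouchi condition for \<open>k\<close> and \<open>k + 1\<close>, the
  monomial is symmetric in these two variables, and so is the sum over all completions of
  the columns still to be read, whence these terms cancel (\<open>sum_extensions_hybrid_term_0\<close>).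
  What remains is \<open>alternant_times_skew_factorial_schur\<close>: the theorem with alternants.

  The symmetry needed twice here is \<open>sum_extensions_symmetric\<close>. Fillings that differ only by
  exchanging \<open>k\<close> and \<open>k + 1\<close> form a product over the rows, and the sum over one row is a divided
  difference, hence symmetric (\<open>row_sum_commute\<close>).

  For \<open>\<lambda> = \<kappa> = \<emptyset>\<close> a single term survives, which gives the bialternant formula \<open>a\<^sub>\<mu> = a\<^sub>\<emptyset> s\<^sub>\<mu>\<close>
  (\<open>alternant_times_factorial_schur\<close>). Together the two results prove the theorem multiplied by
  \<open>a\<^sub>\<emptyset>\<close>. In a ring with zero divisors this factor is removed by perturbing \<open>x\<close> with powers of a
  polynomial variable, which makes \<open>a\<^sub>\<emptyset>\<close> monic (\<open>alternant_generic_monic\<close>).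
\<close>

section \<open>Antisymmetrization\<close>

definition alternate :: "nat \<Rightarrow> ((nat \<Rightarrow> 'a) \<Rightarrow> 'a) \<Rightarrow> (nat \<Rightarrow> 'a) \<Rightarrow> 'a :: comm_ring_1" where
  "alternate d f x = (\<Sum>p | p permutes {1..d}. of_int (sign p) * f (x \<circ> p))"

lemma alternate_sum:
  "alternate d (\<lambda>x. \<Sum>i\<in>I. f i x) x = (\<Sum>i\<in>I. alternate d (f i) x)"
  unfolding alternate_def by (subst sum.swap) (simp add: sum_distrib_left)

lemma alternate_cmult:
  "alternate d (\<lambda>x. c * f x) x = c * alternate d f x"
  unfolding alternate_def by (simp add: sum_distrib_left mult_ac)

lemma alternate_cong:
  assumes "\<And>x. f x = g x"
  shows "alternate d f x = alternate d g x"
  using assms by (simp add: alternate_def)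

lemma alternate_mult_symmetric:
  assumes "\<And>p. p permutes {1..d} \<Longrightarrow> g (x \<circ> p) = g x"
  shows "alternate d (\<lambda>x. f x * g x) x = alternate d f x * g x"
  unfolding alternate_def sum_distrib_right
  by (rule sum.cong) (simp_all add: assms mult.assoc del: One_nat_def)

text \<open>
  Pairing every even permutation with an odd one, instead of deducing \<open>s = - s\<close>, keeps the
  argument valid in characteristic 2.
\<close>

lemma alternate_eq_0:
  assumes inv: "\<And>x. f (x \<circ> transpose a b) = f x"
    and ab: "a \<in> {1..d}" "b \<in> {1..d}" "a \<noteq> b"
  shows "alternate d f x = 0"
proof -
  let ?P = "{p. p permutes {1..d}}" and ?t = "transpose a b"
  have fin: "finite ?P" by (simp add: finite_permutations)
  have perm: "permutation p" if "p permutes {1..d}" for p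
    using that by (auto simp: permutation_permutes)
  have tp: "?t permutes {1..d}" using ab by (intro permutes_swap_id)
  have ev: "evenperm (p \<circ> ?t) \<longleftrightarrow> \<not> evenperm p" if "p permutes {1..d}" for p
    using evenperm_comp[OF perm[OF that] perm[OF tp]] evenperm_swap[of a b] ab(3) by simp
  have "alternate d f x =
      (\<Sum>p\<in>{p\<in>?P. evenperm p}. of_int (sign p) * f (x \<circ> p)) +
      (\<Sum>p\<in>{p\<in>?P. \<not> evenperm p}. of_int (sign p) * f (x \<circ> p))"
    unfolding alternate_def
    by (subst sum.union_disjoint[symmetric]) (use fin in \<open>auto intro!: sum.cong\<close>)
  also have "(\<Sum>p\<in>{p\<in>?P. \<not> evenperm p}. of_int (sign p) * f (x \<circ> p)) =
      (\<Sum>p\<in>{p\<in>?P. evenperm p}. - (of_int (sign p) * f (x \<circ> p)))"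
  proof (rule sum.reindex_bij_witness[where i = "\<lambda>p. p \<circ> ?t" and j = "\<lambda>p. p \<circ> ?t"])
    fix p assume p: "p \<in> {p\<in>?P. \<not> evenperm p}"
    show "(p \<circ> ?t) \<circ> ?t = p" by (simp add: comp_assoc)
    show "p \<circ> ?t \<in> {p\<in>?P. evenperm p}"
      using p ev[of p] permutes_compose[OF tp, of p] by auto
    have "f (x \<circ> (p \<circ> ?t)) = f (x \<circ> p)" using inv[of "x \<circ> p"] by (simp add: comp_assoc)
    then show "- (of_int (sign (p \<circ> ?t)) * f (x \<circ> (p \<circ> ?t))) = of_int (sign p) * f (x \<circ> p)"
      using p ev[of p] by (simp add: sign_def)
  next
    fix p assume p: "p \<in> {p\<in>?P. evenperm p}"
    show "(p \<circ> ?t) \<circ> ?t = p" by (simp add: comp_assoc)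
    show "p \<circ> ?t \<in> {p\<in>?P. \<not> evenperm p}"
      using p ev[of p] permutes_compose[OF tp, of p] by auto
  qed
  finally show ?thesis by (simp only: sum_negf add.right_inverse)
qed

text \<open>
  A transposition of distant indices is a shorter transposition conjugated by an adjacent one.
\<close>

lemma symmetric_from_adjacent:
  fixes g :: "(nat \<Rightarrow> 'a) \<Rightarrow> 'b"
  assumes adj: "\<And>k x. 1 \<le> k \<Longrightarrow> k < d \<Longrightarrow> g (x \<circ> transpose k (Suc k)) = g x"
    and p: "p permutes {1..d}"
  shows "g (x \<circ> p) = g x"
proof -
  have up: "g (x \<circ> transpose a (a + Suc n)) = g x" if "1 \<le> a" "a + Suc n \<le> d" for a n x
    using that
  proof (induction n arbitrary: x)
    case 0
    then show ?case using adj[of a x] by (simp add: o_def)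
  next
    case (Suc n)
    let ?s = "transpose (a + Suc n) (Suc (a + Suc n))"
    have "transpose a (a + Suc (Suc n)) = ?s \<circ> transpose a (a + Suc n) \<circ> ?s"
      by (auto simp: fun_eq_iff transpose_def)
    then have "x \<circ> transpose a (a + Suc (Suc n)) = ((x \<circ> ?s) \<circ> transpose a (a + Suc n)) \<circ> ?s"
      by (simp add: comp_assoc)
    then have "g (x \<circ> transpose a (a + Suc (Suc n))) = g (((x \<circ> ?s) \<circ> transpose a (a + Suc n)) \<circ> ?s)"
      by simp
    also have "\<dots> = g ((x \<circ> ?s) \<circ> transpose a (a + Suc n))"
      by (rule adj) (use Suc.prems in simp_all)
    also have "\<dots> = g (x \<circ> ?s)" by (rule Suc.IH) (use Suc.prems in simp_all)
    also have "\<dots> = g x" by (rule adj) (use Suc.prems in simp_all)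
    finally show ?case .
  qed
  have tr: "g (x \<circ> transpose a b) = g x" if "a \<in> {1..d}" "b \<in> {1..d}" "a \<noteq> b" for a b x
  proof (cases "a < b")
    case True
    then show ?thesis using up[of a "b - a - 1" x] that by simp
  next
    case False
    then show ?thesis using up[of b "a - b - 1" x] that by (simp add: transpose_commute)
  qed
  show ?thesis using p finite_atLeastAtMost
  proof (induction p arbitrary: x rule: permutes_induct)
    case (swap a b p)
    have "g (x \<circ> (transpose a b \<circ> p)) = g ((x \<circ> transpose a b) \<circ> p)"
      by (simp only: comp_assoc)
    also have "\<dots> = g (x \<circ> transpose a b)" by (rule swap.IH)
    also have "\<dots> = g x" by (rule tr) (use swap in simp_all)
    finally show ?case .
  qed simp_all
qed

section \<open>Sums over one row\<close>

text \<open>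
  Consider, in one row, the boxes whose entry may be either \<open>k\<close> or \<open>k + 1\<close>. Columns are counted from
  the right and rows increase to the right, so the columns holding \<open>k + 1\<close> form a lower subset.
  With \<open>p\<close> and \<open>q\<close> in the roles of \<open>x\<close> at \<open>k + 1\<close> and at \<open>k\<close>, the sum below is the total weight of
  these fillings; the shift in \<open>z (Suc c)\<close> is there because the index of \<open>y\<close> belonging to an entry
  decreases by one when the entry grows by one.
\<close>

definition lower_subsets :: "nat set \<Rightarrow> nat set set" where
  "lower_subsets I = {U. U \<subseteq> I \<and> (\<forall>c\<in>U. \<forall>c'\<in>I. c' < c \<longrightarrow> c' \<in> U)}"

definition row_sum :: "nat set \<Rightarrow> (nat \<Rightarrow> 'a) \<Rightarrow> 'a \<Rightarrow> 'a \<Rightarrow> 'a :: comm_ring_1" where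
  "row_sum I z p q = (\<Sum>U\<in>lower_subsets I. (\<Prod>c\<in>U. p - z c) * (\<Prod>c\<in>I - U. q - z (Suc c)))"

lemma finite_lower_subsets: "finite I \<Longrightarrow> finite (lower_subsets I)"
  unfolding lower_subsets_def by (rule finite_subset[of _ "Pow I"]) auto

lemma lower_subsets_Suc:
  "lower_subsets {a..<a + Suc n} = insert {a..<a + Suc n} (lower_subsets {a..<a + n})"
proof (intro set_eqI iffI)
  fix U assume U: "U \<in> lower_subsets {a..<a + Suc n}"
  show "U \<in> insert {a..<a + Suc n} (lower_subsets {a..<a + n})"
  proof (cases "a + n \<in> U")
    case True
    have "c \<in> U" if "c \<in> {a..<a + Suc n}" for c
    proof (cases "c = a + n")
      case False
      then show ?thesis using True U that by (auto simp: lower_subsets_def)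
    qed (use True in simp)
    then have "U = {a..<a + Suc n}" using U by (auto simp: lower_subsets_def)
    then show ?thesis by simp
  next
    case False
    have "U \<subseteq> {a..<a + n}"
    proof
      fix c assume "c \<in> U"
      then have "c \<in> {a..<a + Suc n}" "c \<noteq> a + n" using U False by (auto simp: lower_subsets_def)
      then show "c \<in> {a..<a + n}" by simp
    qed
    then show ?thesis using U by (auto simp: lower_subsets_def)
  qed
next
  fix U assume "U \<in> insert {a..<a + Suc n} (lower_subsets {a..<a + n})"
  then show "U \<in> lower_subsets {a..<a + Suc n}" by (auto simp: lower_subsets_def)
qed

lemma row_sum_Suc:
  fixes z :: "nat \<Rightarrow> 'a :: comm_ring_1"
  shows "row_sum {a..<a + Suc n} z p q =
    row_sum {a..<a + n} z p q * (q - z (Suc (a + n))) + (\<Prod>c\<in>{a..<a + Suc n}. p - z c)"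
proof -
  let ?I = "{a..<a + n}" and ?J = "{a..<a + Suc n}"
  let ?t = "\<lambda>I U. (\<Prod>c\<in>U. p - z c) * (\<Prod>c\<in>I - U. q - z (Suc c))"
  have new: "?J \<notin> lower_subsets ?I" by (auto simp: lower_subsets_def)
  have "?t ?J U = ?t ?I U * (q - z (Suc (a + n)))" if "U \<in> lower_subsets ?I" for U
  proof -
    have "U \<subseteq> ?I" using that by (auto simp: lower_subsets_def)
    then have "?J - U = insert (a + n) (?I - U)" by auto
    then show ?thesis by (simp add: mult_ac)
  qed
  then have "(\<Sum>U\<in>lower_subsets ?I. ?t ?J U) = row_sum ?I z p q * (q - z (Suc (a + n)))"
    by (simp add: row_sum_def sum_distrib_right)
  then show ?thesis
    unfolding row_sum_def[of ?J] lower_subsets_Suc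
    using new by (subst sum.insert) (simp_all add: finite_lower_subsets add.commute)
qed

lemma row_sum_empty: "row_sum {} z p q = 1"
proof -
  have "lower_subsets {} = {{}}" by (auto simp: lower_subsets_def)
  then show ?thesis by (simp add: row_sum_def)
qed

text \<open>
  The row sum is the divided difference of \<open>t \<mapsto> \<Prod>(t - z c)\<close> at \<open>p\<close> and \<open>q\<close>, which makes its
  symmetry plausible. Since \<open>p - q\<close> cannot be cancelled in a general ring, the symmetry itself is
  proved by the same recursion, with this identity as the correction term.
\<close>

lemma row_sum_difference:
  fixes z :: "nat \<Rightarrow> 'a :: comm_ring_1"
  shows "(p - q) * row_sum {a..<a + n} z p q =
    (\<Prod>c\<in>{a..<a + Suc n}. p - z c) - (\<Prod>c\<in>{a..<a + Suc n}. q - z c)"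
proof (induction n)
  case 0
  have "(\<Prod>c\<in>{a..<a + Suc 0}. t - z c) = t - z a" for t by simp
  moreover have "{a..<a + 0} = {}" by simp
  ultimately show ?case by (simp only: row_sum_empty) (simp only: mult_1_right diff_diff_eq2 diff_add_cancel add_diff_eq diff_add_eq)
next
  case (Suc n)
  define s where "s = row_sum {a..<a + n} z p q"
  define w where "w = z (Suc (a + n))"
  define P where "P = (\<lambda>t. \<Prod>c\<in>{a..<a + Suc n}. t - z c)"
  have IH: "(p - q) * s = P p - P q" by (simp only: s_def P_def Suc.IH)
  have P_Suc: "(\<Prod>c\<in>{a..<a + Suc (Suc n)}. t - z c) = P t * (t - w)" for t
    by (simp add: P_def w_def)
  have "(p - q) * row_sum {a..<a + Suc n} z p q = (p - q) * (s * (q - w) + P p)"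
    by (simp only: row_sum_Suc s_def w_def P_def)
  also have "\<dots> = ((p - q) * s) * (q - w) + (p - q) * P p" by (simp add: algebra_simps)
  also have "\<dots> = P p * (p - w) - P q * (q - w)" unfolding IH by (simp add: algebra_simps)
  finally show ?case by (simp only: P_Suc)
qed

lemma row_sum_commute_interval:
  fixes z :: "nat \<Rightarrow> 'a :: comm_ring_1"
  shows "row_sum {a..<a + n} z p q = row_sum {a..<a + n} z q p"
proof (induction n)
  case 0
  then show ?case by (simp add: row_sum_empty)
next
  case (Suc n)
  define s where "s = row_sum {a..<a + n} z p q"
  define P where "P = (\<Prod>c\<in>{a..<a + Suc n}. p - z c)"
  define Q where "Q = (\<Prod>c\<in>{a..<a + Suc n}. q - z c)"
  have "row_sum {a..<a + n} z q p = s" by (simp only: s_def Suc.IH)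
  then have "row_sum {a..<a + Suc n} z p q - row_sum {a..<a + Suc n} z q p =
      (s * (q - z (Suc (a + n))) + P) - (s * (p - z (Suc (a + n))) + Q)"
    by (simp only: row_sum_Suc s_def P_def Q_def)
  also have "\<dots> = (P - Q) - (p - q) * s" by (simp add: algebra_simps)
  also have "\<dots> = 0" by (simp only: s_def P_def Q_def row_sum_difference diff_self)
  finally show ?case by (simp only: right_minus_eq)
qed

lemma row_sum_commute:
  fixes z :: "nat \<Rightarrow> 'a :: comm_ring_1"
  assumes fin: "finite I"
    and conv: "\<And>a b c. a \<in> I \<Longrightarrow> c \<in> I \<Longrightarrow> a \<le> b \<Longrightarrow> b \<le> c \<Longrightarrow> b \<in> I"
  shows "row_sum I z p q = row_sum I z q p"
proof (cases "I = {}")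
  case False
  define m M where "m = Min I" and "M = Max I"
  have mM: "m \<in> I" "M \<in> I" "\<And>c. c \<in> I \<Longrightarrow> m \<le> c" "\<And>c. c \<in> I \<Longrightarrow> c \<le> M"
    using fin False by (simp_all add: m_def M_def)
  have "I = {m..<m + (Suc M - m)}"
  proof (intro set_eqI iffI)
    fix c assume "c \<in> {m..<m + (Suc M - m)}"
    then show "c \<in> I" using conv[OF mM(1,2), of c] mM(3)[OF mM(2)] by simp
  next
    fix c assume "c \<in> I"
    then show "c \<in> {m..<m + (Suc M - m)}" using mM(3,4)[of c] by simp
  qed
  then show ?thesis using row_sum_commute_interval[of m "Suc M - m" z p q] by (simp only:)
qed (simp add: row_sum_empty)

section \<open>Semistandard fillings of a skew diagram\<close>

lemma partitions_antimono:
  assumes "lam \<in> partitions d" "1 \<le> i" "i \<le> j" "j \<le> d"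
  shows "lam j \<le> lam i"
  using assms(3,4)
proof (induction rule: dec_induct)
  case (step n)
  then have "lam (Suc n) \<le> lam n" using assms(1,2) by (simp add: partitions_def)
  with step show ?case by simp
qed simp

definition box_weight :: "nat \<Rightarrow> (int \<Rightarrow> 'a) \<Rightarrow> (nat \<Rightarrow> 'a) \<Rightarrow> nat \<Rightarrow> nat \<times> nat \<Rightarrow> 'a :: comm_ring_1" where
  "box_weight d y x v b = x v - y (dual_index d (int v) + int (snd b) - int (fst b))"

locale skew_shape =
  fixes d :: nat and mu kap :: "nat \<Rightarrow> nat"
  assumes mu: "mu \<in> partitions d" and kap: "kap \<in> partitions d"
begin

abbreviation D :: "(nat \<times> nat) set" where "D \<equiv> skew_diagram d mu kap"

lemma D_iff: "(r, c) \<in> D \<longleftrightarrow> 1 \<le> r \<and> r \<le> d \<and> kap r < c \<and> c \<le> mu r"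
  by (simp add: skew_diagram_def)

lemma column_le_mu1: "(r, c) \<in> D \<Longrightarrow> c \<le> mu 1"
  using partitions_antimono[OF mu, of 1 r] by (auto simp: D_iff)

lemma finite_D [simp]: "finite D"
proof (rule finite_subset)
  show "D \<subseteq> {1..d} \<times> {..mu 1}" using column_le_mu1 by (auto simp: D_iff)
qed simp

text \<open>
  Both \<open>\<kappa>\<close> and \<open>\<mu>\<close> decrease from row to row, so the lower bound on the column is inherited from the
  corner with the smallest row and column, the upper bound from the opposite corner. All adjacency
  arguments about tableaux below need no more about the shape than this.
\<close>

lemma D_convex:
  assumes "(r, c) \<in> D" "(r', c') \<in> D" "r \<le> s" "s \<le> r'" "c \<le> e" "e \<le> c'"
  shows "(s, e) \<in> D"
  using partitions_antimono[OF kap, of r s] partitions_antimono[OF mu, of s r'] assms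
  by (auto simp: D_iff)

lemma filling_range: "R \<in> fillings d mu kap \<Longrightarrow> b \<in> D \<Longrightarrow> R b \<in> {1..d}"
  by (auto simp: fillings_def)

lemma filling_row:
  "R \<in> fillings d mu kap \<Longrightarrow> (r, c) \<in> D \<Longrightarrow> (r, c') \<in> D \<Longrightarrow> c \<le> c' \<Longrightarrow> R (r, c') \<le> R (r, c)"
  by (cases "c = c'") (auto simp: fillings_def semistandard_def)

lemma filling_column:
  "R \<in> fillings d mu kap \<Longrightarrow> (r, c) \<in> D \<Longrightarrow> (r', c) \<in> D \<Longrightarrow> r < r' \<Longrightarrow> R (r', c) < R (r, c)"
  by (auto simp: fillings_def semistandard_def)

lemma filling_column_inj:
  "R \<in> fillings d mu kap \<Longrightarrow> (r, c) \<in> D \<Longrightarrow> (r', c) \<in> D \<Longrightarrow> R (r, c) = R (r', c) \<Longrightarrow> r = r'"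
  using filling_column[of R r c r'] filling_column[of R r' c r] by (cases r r' rule: linorder_cases) auto

lemma finite_fillings [simp]: "finite (fillings d mu kap)"
  by (rule finite_subset[of _ "D \<rightarrow>\<^sub>E {1..d}"]) (auto simp: fillings_def intro!: finite_PiE)

section \<open>Symmetry under adjacent transpositions\<close>

lemma column_pair:
  assumes R: "R \<in> fillings d mu kap" and D: "(r, c) \<in> D" "(r', c) \<in> D" "r < r'"
    and v: "R (r, c) \<in> {k, Suc k}" "R (r', c) \<in> {k, Suc k}"
  shows "r' = Suc r" "R (r', c) = k" "R (r, c) = Suc k"
proof -
  have "R (r', c) < R (r, c)" by (rule filling_column[OF R D])
  then show v': "R (r', c) = k" "R (r, c) = Suc k" using v by auto
  show "r' = Suc r"
  proof (rule ccontr)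
    assume "r' \<noteq> Suc r"
    then have r: "r < Suc r" "Suc r < r'" using D(3) by auto
    then have "(Suc r, c) \<in> D" using D_convex[OF D(1,2), of "Suc r" c] by simp
    then show False
      using filling_column[OF R D(1) _ r(1)] filling_column[OF R _ D(2) r(2)] v' by fastforce
  qed
qed

text \<open>
  A column contains at most one \<open>k\<close> and one \<open>k + 1\<close>. If it contains both, they sit on top of each other
  and cannot be changed; an entry that is alone in its column is free. Only columns from \<open>j\<close> on are
  considered, because the cancellation below keeps the earlier columns fixed.
\<close>

definition free_boxes :: "nat \<Rightarrow> nat \<Rightarrow> (nat \<times> nat \<Rightarrow> nat) \<Rightarrow> (nat \<times> nat) set" where
  "free_boxes k j R = {b \<in> D. j \<le> snd b \<and> R b \<in> {k, Suc k} \<and>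
     (\<forall>b'\<in>D. snd b' = snd b \<longrightarrow> R b' \<in> {k, Suc k} \<longrightarrow> b' = b)}"

text \<open>
  A label for the classes of fillings that agree up to exchanging \<open>k\<close> and \<open>k + 1\<close> from column \<open>j\<close> on.
\<close>

definition merge :: "nat \<Rightarrow> nat \<Rightarrow> (nat \<times> nat \<Rightarrow> nat) \<Rightarrow> nat \<times> nat \<Rightarrow> nat" where
  "merge k j R = (\<lambda>b. if b \<in> D \<and> j \<le> snd b \<and> R b = Suc k then k else R b)"

definition extensions :: "nat \<Rightarrow> (nat \<times> nat \<Rightarrow> nat) \<Rightarrow> (nat \<times> nat \<Rightarrow> nat) set" where
  "extensions j T = {R \<in> fillings d mu kap. \<forall>b\<in>D. snd b < j \<longrightarrow> R b = T b}"

text \<open>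
  The last fixed column restricts the entries to its left. An entry \<open>k\<close> there forbids \<open>k + 1\<close> next to
  it and so would spoil the symmetry, unless a \<open>k + 1\<close> stands below it: then the entry below its
  neighbour is at most \<open>k + 1\<close>, and the neighbour could not be \<open>k + 1\<close> anyway.
\<close>

definition boundary_paired :: "nat \<Rightarrow> nat \<Rightarrow> (nat \<times> nat \<Rightarrow> nat) \<Rightarrow> bool" where
  "boundary_paired k j T \<longleftrightarrow>
     (\<forall>r c. Suc c = j \<longrightarrow> (r, c) \<in> D \<longrightarrow> T (r, c) = k \<longrightarrow> (\<exists>r'. (r', c) \<in> D \<and> T (r', c) = Suc k))"

lemma free_boxesD:
  assumes "(r, c) \<in> free_boxes k j R"
  shows "(r, c) \<in> D" "j \<le> c" "R (r, c) \<in> {k, Suc k}"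
    "\<And>r'. (r', c) \<in> D \<Longrightarrow> R (r', c) \<in> {k, Suc k} \<Longrightarrow> r' = r"
  using assms unfolding free_boxes_def by auto

lemma paired_partner:
  assumes "(r, c) \<in> D" "j \<le> c" "R (r, c) \<in> {k, Suc k}" "(r, c) \<notin> free_boxes k j R"
  obtains r' where "(r', c) \<in> D" "R (r', c) \<in> {k, Suc k}" "r' \<noteq> r"
proof -
  have "\<exists>b'\<in>D. snd b' = c \<and> R b' \<in> {k, Suc k} \<and> b' \<noteq> (r, c)"
    using assms unfolding free_boxes_def mem_Collect_eq snd_conv by blast
  then obtain b' where b': "b' \<in> D" "snd b' = c" "R b' \<in> {k, Suc k}" "b' \<noteq> (r, c)" by blast
  then have "b' = (fst b', c)" by (simp add: prod_eq_iff)
  with b' have "(fst b', c) \<in> D" "R (fst b', c) \<in> {k, Suc k}" "fst b' \<noteq> r" by metis+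
  then show thesis by (rule that)
qed

text \<open>
  If the box to the right of a free box held \<open>k\<close>, it would have a partner \<open>k + 1\<close> below it. Then the
  box below the free box belongs to the shape as well, and its entry is squeezed to \<open>k + 1\<close>, so that
  the free box would be paired too.
\<close>

lemma right_of_free:
  assumes R: "R \<in> fillings d mu kap"
    and free: "(r, c') \<in> free_boxes k j R" and D: "(r, c) \<in> D" "(r, c) \<notin> free_boxes k j R" "c < c'"
    and bd: "boundary_paired k j R"
  shows "Suc k \<le> R (r, c)"
proof (rule ccontr)
  assume "\<not> Suc k \<le> R (r, c)"
  note f = free_boxesD[OF free]
  have "R (r, c') \<le> R (r, c)" using filling_row[OF R D(1) f(1)] D(3) by simp
  with f(3) \<open>\<not> Suc k \<le> R (r, c)\<close> have k: "R (r, c) = k" "R (r, c') = k" by auto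
  \<comment> \<open>If column \<open>c\<close> is fixed, the box in the last fixed column is also \<open>k\<close> and replaces it.\<close>
  have "\<exists>e r'. c \<le> e \<and> e < c' \<and> (r, e) \<in> D \<and> R (r, e) = k \<and>
      (r', e) \<in> D \<and> R (r', e) \<in> {k, Suc k} \<and> r' \<noteq> r"
  proof (cases "j \<le> c")
    case True
    have "R (r, c) \<in> {k, Suc k}" using k by simp
    from paired_partner[OF D(1) True this D(2)] show ?thesis using D k by blast
  next
    case False
    then obtain e where e: "j = Suc e" "c \<le> e" "e < c'" using f(2) by (cases j) auto
    then have De: "(r, e) \<in> D" using D_convex[OF D(1) f(1), of r e] by simp
    have "R (r, e) = k"
      using filling_row[OF R D(1) De e(2)] filling_row[OF R De f(1)] e k by simp
    moreover from this obtain r' where "(r', e) \<in> D" "R (r', e) = Suc k"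
      using bd e De by (auto simp: boundary_paired_def)
    moreover from calculation have "r' \<noteq> r" by auto
    ultimately show ?thesis using e De by blast
  qed
  then obtain e r' where e: "c \<le> e" "e < c'" "(r, e) \<in> D" "R (r, e) = k"
    "(r', e) \<in> D" "R (r', e) \<in> {k, Suc k}" "r' \<noteq> r" by blast
  have ke: "R (r, e) \<in> {k, Suc k}" using e by simp
  have "\<not> r < r'" using column_pair(3)[OF R e(3,5) _ ke e(6)] e(4) by auto
  then have lt: "r' < r" using e(7) by simp
  note p = column_pair[OF R e(5,3) lt e(6) ke]
  have D': "(r', c') \<in> D" using D_convex[OF e(5) f(1), of r' c'] lt e(2) by simp
  have "R (r', c') \<le> Suc k" using filling_row[OF R e(5) D'] e(2) p(3) by simp
  moreover have "R (r, c') < R (r', c')" by (rule filling_column[OF R D' f(1) lt])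
  ultimately have "R (r', c') \<in> {k, Suc k}" using k by auto
  then show False using f(4)[OF D'] lt by simp
qed

text \<open>
  The mirror image: a \<open>k + 1\<close> to the left has a partner \<open>k\<close> above it, which squeezes the entry
  above the free box to \<open>k\<close>.
\<close>

lemma left_of_free:
  assumes R: "R \<in> fillings d mu kap"
    and free: "(r, c) \<in> free_boxes k j R" and D: "(r, c') \<in> D" "(r, c') \<notin> free_boxes k j R" "c < c'"
  shows "R (r, c') \<le> k"
proof (rule ccontr)
  assume nk: "\<not> R (r, c') \<le> k"
  note f = free_boxesD[OF free]
  have "R (r, c') \<le> R (r, c)" using filling_row[OF R f(1) D(1)] D(3) by simp
  with f(3) nk have k: "R (r, c) = Suc k" "R (r, c') = Suc k" by auto
  have k': "R (r, c') \<in> {k, Suc k}" using k by simp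
  have "j \<le> c'" using f(2) D(3) by simp
  from paired_partner[OF D(1) this k' D(2)] obtain r' where
    r': "(r', c') \<in> D" "R (r', c') \<in> {k, Suc k}" "r' \<noteq> r" by blast
  have "\<not> r' < r" using column_pair(2)[OF R r'(1) D(1) _ r'(2) k'] k by auto
  then have lt: "r < r'" using r'(3) by simp
  note p = column_pair[OF R D(1) r'(1) lt k' r'(2)]
  have D': "(r', c) \<in> D" using D_convex[OF f(1) r'(1), of r' c] lt D(3) by simp
  have "k \<le> R (r', c)" using filling_row[OF R D' r'(1)] D(3) p(2) by simp
  moreover have "R (r', c) < R (r, c)" by (rule filling_column[OF R f(1) D' lt])
  ultimately have "R (r', c) \<in> {k, Suc k}" using k by auto
  then show False using f(4)[OF D'] lt by simp
qed

text \<open>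
  The set \<open>g r\<close> lists the columns in which the free boxes of row \<open>r\<close> receive \<open>k + 1\<close>.
\<close>

definition refill :: "nat \<Rightarrow> nat \<Rightarrow> (nat \<times> nat \<Rightarrow> nat) \<Rightarrow> (nat \<Rightarrow> nat set) \<Rightarrow> nat \<times> nat \<Rightarrow> nat" where
  "refill k j R g = (\<lambda>b\<in>D. if b \<in> free_boxes k j R then if snd b \<in> g (fst b) then Suc k else k else R b)"

definition free_row :: "nat \<Rightarrow> nat \<Rightarrow> (nat \<times> nat \<Rightarrow> nat) \<Rightarrow> nat \<Rightarrow> nat set" where
  "free_row k j R r = {c. (r, c) \<in> free_boxes k j R}"

lemma free_boxes_subset: "free_boxes k j R \<subseteq> {b \<in> D. j \<le> snd b}"
  unfolding free_boxes_def by blast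

lemma finite_free_row [simp]: "finite (free_row k j R r)"
proof (rule finite_subset)
  show "free_row k j R r \<subseteq> {..mu 1}"
    using column_le_mu1[OF free_boxesD(1)] by (auto simp: free_row_def)
qed simp

lemma free_boxes_eq_Sigma: "free_boxes k j R = Sigma {1..d} (free_row k j R)"
proof (intro set_eqI iffI)
  fix b assume b: "b \<in> free_boxes k j R"
  obtain r c where rc: "b = (r, c)" by (cases b)
  have "(r, c) \<in> D" using free_boxesD(1) b rc by simp
  then show "b \<in> Sigma {1..d} (free_row k j R)" using b rc by (simp add: D_iff free_row_def)
qed (auto simp: free_row_def)

lemma free_row_convex:
  assumes R: "R \<in> fillings d mu kap"
    and a: "a \<in> free_row k j R r" and c: "c \<in> free_row k j R r" and b: "a \<le> b" "b \<le> c"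
  shows "b \<in> free_row k j R r"
proof (rule ccontr)
  assume nb: "b \<notin> free_row k j R r"
  then have ab: "a < b" "b < c" using a c b by (auto simp: le_less)
  have a': "(r, a) \<in> free_boxes k j R" and c': "(r, c) \<in> free_boxes k j R"
    and nb': "(r, b) \<notin> free_boxes k j R" using a c nb by (auto simp: free_row_def)
  note fa = free_boxesD[OF a'] and fc = free_boxesD[OF c']
  have Db: "(r, b) \<in> D" using D_convex[OF fa(1) fc(1), of r b] b by simp
  have le: "R (r, b) \<le> k" by (rule left_of_free[OF R a' Db nb' ab(1)])
  have "R (r, c) \<le> R (r, b)" using filling_row[OF R Db fc(1)] b by simp
  with le fc(3) have k: "R (r, b) = k" "R (r, c) = k" by auto
  have kb: "R (r, b) \<in> {k, Suc k}" using k by simp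
  have "j \<le> b" using fa(2) b by simp
  from paired_partner[OF Db this kb nb'] obtain r' where
    r': "(r', b) \<in> D" "R (r', b) \<in> {k, Suc k}" "r' \<noteq> r" by blast
  have "\<not> r < r'" using column_pair(3)[OF R Db r'(1) _ kb r'(2)] k by auto
  then have lt: "r' < r" using r'(3) by simp
  note p = column_pair[OF R r'(1) Db lt r'(2) kb]
  have D': "(r', c) \<in> D" using D_convex[OF r'(1) fc(1), of r' c] lt ab by simp
  have "R (r', c) \<le> Suc k" using filling_row[OF R r'(1) D'] b p(3) by simp
  moreover have "R (r, c) < R (r', c)" by (rule filling_column[OF R D' fc(1) lt])
  ultimately have "R (r', c) \<in> {k, Suc k}" using k by auto
  then show False using fc(4)[OF D'] lt by simp
qed

text \<open>
  The free boxes of different rows do not constrain each other: two boxes of one column are never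
  both free, and next to a free box the fixed entries of its row leave room for both values.
\<close>

lemma refill_in_fillings:
  assumes R: "R \<in> fillings d mu kap" and bd: "boundary_paired k j R" and k: "1 \<le> k" "k < d"
    and g: "g \<in> Pi\<^sub>E {1..d} (\<lambda>r. lower_subsets (free_row k j R r))"
  shows "refill k j R g \<in> fillings d mu kap"
proof -
  let ?F = "free_boxes k j R" and ?Q = "refill k j R g"
  have Q: "?Q (r, c) = (if (r, c) \<in> ?F then if c \<in> g r then Suc k else k else R (r, c))"
    if "(r, c) \<in> D" for r c using that by (simp add: refill_def)
  have "?Q \<in> D \<rightarrow>\<^sub>E {1..d}"
    using filling_range[OF R] k by (auto simp: refill_def)
  moreover have "?Q (r, c') \<le> ?Q (r, c)" if D: "(r, c) \<in> D" "(r, c') \<in> D" "c < c'" for r c c'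
  proof -
    consider "(r, c) \<in> ?F" "(r, c') \<in> ?F" | "(r, c) \<in> ?F" "(r, c') \<notin> ?F"
      | "(r, c) \<notin> ?F" "(r, c') \<in> ?F" | "(r, c) \<notin> ?F" "(r, c') \<notin> ?F" by blast
    then show ?thesis
    proof cases
      case 1
      have "r \<in> {1..d}" using D by (simp add: D_iff)
      then have "g r \<in> lower_subsets (free_row k j R r)" using g by auto
      then have "c' \<in> g r \<longrightarrow> c \<in> g r" using 1 D by (auto simp: lower_subsets_def free_row_def)
      then show ?thesis using 1 D by (simp add: Q)
    next
      case 2
      then show ?thesis using left_of_free[OF R 2(1) D(2) 2(2) D(3)] D by (simp add: Q)
    next
      case 3
      then show ?thesis using right_of_free[OF R 3(2) D(1) 3(1) D(3) bd] D by (simp add: Q)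
    next
      case 4
      then show ?thesis using filling_row[OF R D(1,2)] D by (simp add: Q)
    qed
  qed
  moreover have "?Q (r', c) < ?Q (r, c)" if D: "(r, c) \<in> D" "(r', c) \<in> D" "r < r'" for r r' c
  proof -
    have lt: "R (r', c) < R (r, c)" by (rule filling_column[OF R D])
    consider "(r, c) \<in> ?F" | "(r, c) \<notin> ?F" "(r', c) \<in> ?F" | "(r, c) \<notin> ?F" "(r', c) \<notin> ?F"
      by blast
    then show ?thesis
    proof cases
      case 1
      note f = free_boxesD[OF 1]
      have "R (r', c) \<notin> {k, Suc k}" using f(4)[OF D(2)] D(3) by auto
      moreover from this have "(r', c) \<notin> ?F" using free_boxesD(3) by blast
      ultimately show ?thesis using 1 f(3) lt D by (auto simp: Q)
    next
      case 2
      note f = free_boxesD[OF 2(2)]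
      have "R (r, c) \<notin> {k, Suc k}" using f(4)[OF D(1)] D(3) by auto
      then show ?thesis using 2 f(3) lt D by (auto simp: Q)
    next
      case 3
      then show ?thesis using lt D by (simp add: Q)
    qed
  qed
  ultimately show ?thesis unfolding fillings_def semistandard_def by blast
qed

lemma merge_eqD:
  assumes "merge k j R' = merge k j R" "b \<in> D" "j \<le> snd b"
  shows "R' b \<in> {k, Suc k} \<longleftrightarrow> R b \<in> {k, Suc k}" "R b \<notin> {k, Suc k} \<Longrightarrow> R' b = R b"
  using fun_cong[OF assms(1), of b] assms(2,3) by (auto simp: merge_def split: if_splits)

lemma merge_eq_outside_free:
  assumes R: "R \<in> extensions j T" and R': "R' \<in> extensions j T"
    and eq: "merge k j R' = merge k j R" and b: "b \<in> D" "b \<notin> free_boxes k j R"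
  shows "R' b = R b"
proof -
  have f: "R \<in> fillings d mu kap" "R' \<in> fillings d mu kap" using R R' by (auto simp: extensions_def)
  obtain r c where rc: "b = (r, c)" by (cases b)
  show ?thesis
  proof (cases "j \<le> c \<and> R b \<in> {k, Suc k}")
    case True
    then have v: "R (r, c) \<in> {k, Suc k}" and jc: "j \<le> c" by (auto simp: rc)
    from paired_partner[OF b(1)[unfolded rc] jc v b(2)[unfolded rc]] obtain r' where
      r': "(r', c) \<in> D" "R (r', c) \<in> {k, Suc k}" "r' \<noteq> r" by blast
    have v': "R' (r, c) \<in> {k, Suc k}" "R' (r', c) \<in> {k, Suc k}"
      using merge_eqD(1)[OF eq, of "(r, c)"] merge_eqD(1)[OF eq, of "(r', c)"] v r' b rc jc by auto
    show ?thesis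
    proof (cases "r < r'")
      case True
      then show ?thesis
        using column_pair(3)[OF f(1) b(1)[unfolded rc] r'(1) True v r'(2)]
          column_pair(3)[OF f(2) b(1)[unfolded rc] r'(1) True v'] rc by simp
    next
      case False
      then have "r' < r" using r'(3) by simp
      then show ?thesis
        using column_pair(2)[OF f(1) r'(1) b(1)[unfolded rc] _ r'(2) v]
          column_pair(2)[OF f(2) r'(1) b(1)[unfolded rc] _ v'(2,1)] rc by simp
    qed
  next
    case False
    then show ?thesis
      using merge_eqD(2)[OF eq b(1)] R R' b(1) rc by (cases "j \<le> c") (auto simp: extensions_def)
  qed
qed

lemma filling_outside: "R \<in> fillings d mu kap \<Longrightarrow> b \<notin> D \<Longrightarrow> R b = undefined"
  unfolding fillings_def by (blast dest: PiE_arb)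

text \<open>
  Hence a class is a product over the rows, which turns its weight into a product of row sums.
\<close>

lemma sum_merge_class:
  assumes R: "R \<in> extensions j T" and bd: "boundary_paired k j R" and k: "1 \<le> k" "k < d"
  shows "(\<Sum>R' | R' \<in> extensions j T \<and> merge k j R' = merge k j R. f R') =
    (\<Sum>g \<in> Pi\<^sub>E {1..d} (\<lambda>r. lower_subsets (free_row k j R r)). f (refill k j R g))"
proof (rule sum.reindex_bij_witness[where i = "refill k j R" and
      j = "\<lambda>R'. \<lambda>r\<in>{1..d}. {c \<in> free_row k j R r. R' (r, c) = Suc k}"])
  let ?F = "free_boxes k j R"
  let ?g = "\<lambda>R'. \<lambda>r\<in>{1..d}. {c \<in> free_row k j R r. R' (r, c) = Suc k}"
  have Rf: "R \<in> fillings d mu kap" using R by (simp add: extensions_def)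
  {
    fix R' assume "R' \<in> {R'. R' \<in> extensions j T \<and> merge k j R' = merge k j R}"
    then have R': "R' \<in> extensions j T" and eq: "merge k j R' = merge k j R" by auto
    have R'f: "R' \<in> fillings d mu kap" using R' by (simp add: extensions_def)
    have val: "R' (r, c) = k \<or> R' (r, c) = Suc k" if "(r, c) \<in> ?F" for r c
      using merge_eqD(1)[OF eq free_boxesD(1)[OF that]] free_boxesD(2,3)[OF that] by simp
    show inv: "refill k j R (?g R') = R'"
    proof
      fix b :: "nat \<times> nat"
      obtain r c where rc: "b = (r, c)" by (cases b)
      show "refill k j R (?g R') b = R' b"
      proof (cases "(r, c) \<in> D")
        case False
        then show ?thesis using filling_outside[OF R'f False] by (simp add: refill_def rc)
      next
        case True
        then have "r \<in> {1..d}" by (simp add: D_iff)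
        then show ?thesis
          using True val[of r c] merge_eq_outside_free[OF R R' eq True]
          by (auto simp: refill_def rc free_row_def)
      qed
    qed
    show "?g R' \<in> Pi\<^sub>E {1..d} (\<lambda>r. lower_subsets (free_row k j R r))"
    proof (rule PiE_I)
      fix r assume r: "r \<in> {1..d}"
      have "R' (r, c') = Suc k"
        if "c \<in> free_row k j R r" "R' (r, c) = Suc k" "c' \<in> free_row k j R r" "c' < c" for c c'
      proof -
        have "(r, c) \<in> ?F" "(r, c') \<in> ?F" using that by (simp_all add: free_row_def)
        then show ?thesis
          using filling_row[OF R'f free_boxesD(1) free_boxesD(1), of r c' k j R c k j R]
            that val[of r c'] by simp
      qed
      then show "?g R' r \<in> lower_subsets (free_row k j R r)"
        using r by (auto simp: lower_subsets_def)
    next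
      fix r assume "r \<notin> {1..d}"
      then show "?g R' r = undefined" by (simp only: restrict_apply if_False)
    qed
    show "f (refill k j R (?g R')) = f R'" by (simp only: inv)
  }
  fix g assume g: "g \<in> Pi\<^sub>E {1..d} (\<lambda>r. lower_subsets (free_row k j R r))"
  have sub: "g r \<subseteq> free_row k j R r" if "r \<in> {1..d}" for r
    using g that by (auto simp: lower_subsets_def)
  show "?g (refill k j R g) = g"
  proof (rule PiE_ext[of _ "{1..d}" "\<lambda>_. UNIV"])
    fix r assume r: "r \<in> {1..d}"
    have "(r, c) \<in> D" if "c \<in> free_row k j R r" for c
      using that free_boxesD(1) by (simp add: free_row_def)
    then show "?g (refill k j R g) r = g r"
      using r sub[OF r] by (auto simp: refill_def free_row_def)
  qed (use g in auto)
  have Q: "refill k j R g \<in> fillings d mu kap" by (rule refill_in_fillings[OF Rf bd k g])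
  have out: "refill k j R g b = R b" if "b \<in> D" "b \<notin> ?F" for b
    using that by (simp add: refill_def)
  have "refill k j R g b = T b" if "b \<in> D" "snd b < j" for b
  proof -
    have "b \<notin> ?F" using that free_boxes_subset[of k j R] by auto
    then show ?thesis using out[of b] that R by (simp add: extensions_def)
  qed
  then have "refill k j R g \<in> extensions j T" using Q by (simp add: extensions_def)
  moreover have "merge k j (refill k j R g) b = merge k j R b" for b
  proof (cases "b \<in> ?F")
    case True
    then have "b \<in> D" "R b \<in> {k, Suc k}" "j \<le> snd b"
      using free_boxesD(1-3)[of "fst b" "snd b"] by simp_all
    then show ?thesis using True by (auto simp: merge_def refill_def)
  next
    case False
    then show ?thesis using out[of b] filling_outside[OF Q] filling_outside[OF Rf]
      by (cases "b \<in> D") (simp_all add: merge_def)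
  qed
  ultimately show "refill k j R g \<in> {R'. R' \<in> extensions j T \<and> merge k j R' = merge k j R}"
    by auto
qed

text \<open>
  A \<open>k\<close> directly above a \<open>k + 1\<close> has the same index of \<open>y\<close> as its partner, so exchanging \<open>x\<close> at \<open>k\<close> and
  \<open>k + 1\<close> just exchanges the two factors.
\<close>

lemma prod_fixed_boxes_symmetric:
  fixes y :: "int \<Rightarrow> 'a :: comm_ring_1"
  assumes R: "R \<in> fillings d mu kap"
  shows "(\<Prod>b\<in>{b \<in> D. j \<le> snd b} - free_boxes k j R. box_weight d y (x \<circ> transpose k (Suc k)) (R b) b) =
    (\<Prod>b\<in>{b \<in> D. j \<le> snd b} - free_boxes k j R. box_weight d y x (R b) b)"
proof -
  define P where "P = {b \<in> {b \<in> D. j \<le> snd b} - free_boxes k j R. R b \<in> {k, Suc k}}"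
  define N where "N = {b \<in> {b \<in> D. j \<le> snd b} - free_boxes k j R. R b \<notin> {k, Suc k}}"
  have split: "{b \<in> D. j \<le> snd b} - free_boxes k j R = P \<union> N" by (auto simp: P_def N_def)
  have fin: "finite P" "finite N" "P \<inter> N = {}" by (auto simp: P_def N_def)
  let ?p = "\<lambda>b. if R b = k then (fst b - 1, snd b) else (Suc (fst b), snd b)"
  let ?x = "x \<circ> transpose k (Suc k)"
  have partner: "?p b \<in> P \<and> ?p (?p b) = b \<and>
      box_weight d y x (R (?p b)) (?p b) = box_weight d y ?x (R b) b" if "b \<in> P" for b
  proof -
    obtain r c where rc: "b = (r, c)" by (cases b)
    have b: "(r, c) \<in> D" "j \<le> c" "R (r, c) \<in> {k, Suc k}" "(r, c) \<notin> free_boxes k j R"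
      using that by (auto simp: P_def rc)
    from paired_partner[OF b] obtain r' where
      r': "(r', c) \<in> D" "R (r', c) \<in> {k, Suc k}" "r' \<noteq> r" by blast
    have nf: "(r', c) \<notin> free_boxes k j R" using free_boxesD(4)[of r' c k j R r] b(1,3) r'(3) by blast
    have P': "(r', c) \<in> P" using r' nf b(2) by (simp add: P_def)
    show ?thesis
    proof (cases "r < r'")
      case True
      note p = column_pair[OF R b(1) r'(1) True b(3) r'(2)]
      then show ?thesis using P' by (simp add: rc box_weight_def dual_index_def algebra_simps)
    next
      case False
      then have "r' < r" using r'(3) by simp
      note p = column_pair[OF R r'(1) b(1) this r'(2) b(3)]
      then show ?thesis using P' by (simp add: rc box_weight_def dual_index_def algebra_simps)
    qed
  qed
  have "(\<Prod>b\<in>P. box_weight d y ?x (R b) b) = (\<Prod>b\<in>P. box_weight d y x (R b) b)"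
    by (rule prod.reindex_bij_witness[where i = ?p and j = ?p]) (use partner in blast)+
  moreover have "(\<Prod>b\<in>N. box_weight d y ?x (R b) b) = (\<Prod>b\<in>N. box_weight d y x (R b) b)"
    by (rule prod.cong) (auto simp: N_def box_weight_def)
  ultimately show ?thesis unfolding split using fin by (simp add: prod.union_disjoint)
qed

lemma prod_refill:
  fixes y :: "int \<Rightarrow> 'a :: comm_ring_1"
  assumes g: "g \<in> Pi\<^sub>E {1..d} (\<lambda>r. lower_subsets (free_row k j R r))"
  defines "z \<equiv> \<lambda>r c. y (int d - int k + int c - int r)"
  shows "(\<Prod>b\<in>{b \<in> D. j \<le> snd b}. box_weight d y x (refill k j R g b) b) =
    (\<Prod>b\<in>{b \<in> D. j \<le> snd b} - free_boxes k j R. box_weight d y x (R b) b) *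
    (\<Prod>r\<in>{1..d}. (\<Prod>c\<in>g r. x (Suc k) - z r c) * (\<Prod>c\<in>free_row k j R r - g r. x k - z r (Suc c)))"
proof -
  let ?F = "free_boxes k j R" and ?w = "\<lambda>b. box_weight d y x (refill k j R g b) b"
  have "(\<Prod>b\<in>{b \<in> D. j \<le> snd b}. ?w b) = (\<Prod>b\<in>{b \<in> D. j \<le> snd b} - ?F. ?w b) * (\<Prod>b\<in>?F. ?w b)"
    by (rule prod.subset_diff[OF free_boxes_subset]) simp
  also have "(\<Prod>b\<in>{b \<in> D. j \<le> snd b} - ?F. ?w b) =
      (\<Prod>b\<in>{b \<in> D. j \<le> snd b} - ?F. box_weight d y x (R b) b)"
    by (rule prod.cong) (auto simp: refill_def)
  also have "(\<Prod>b\<in>?F. ?w b) = (\<Prod>r\<in>{1..d}. \<Prod>c\<in>free_row k j R r. ?w (r, c))"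
    unfolding free_boxes_eq_Sigma by (subst prod.Sigma) auto
  also have "\<dots> = (\<Prod>r\<in>{1..d}. (\<Prod>c\<in>g r. x (Suc k) - z r c) *
      (\<Prod>c\<in>free_row k j R r - g r. x k - z r (Suc c)))"
  proof (rule prod.cong[OF refl])
    fix r assume r: "r \<in> {1..d}"
    have sub: "g r \<subseteq> free_row k j R r" using g r by (auto simp: lower_subsets_def)
    have w: "?w (r, c) = (if c \<in> g r then x (Suc k) - z r c else x k - z r (Suc c))"
      if "c \<in> free_row k j R r" for c
    proof -
      have "(r, c) \<in> ?F" using that by (simp add: free_row_def)
      then show ?thesis using free_boxesD(1)[of r c k j R]
        by (simp add: refill_def box_weight_def dual_index_def z_def algebra_simps)
    qed
    have "(\<Prod>c\<in>free_row k j R r. ?w (r, c)) =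
        (\<Prod>c\<in>free_row k j R r - g r. ?w (r, c)) * (\<Prod>c\<in>g r. ?w (r, c))"
      by (rule prod.subset_diff[OF sub]) simp
    also have "(\<Prod>c\<in>free_row k j R r - g r. ?w (r, c)) = (\<Prod>c\<in>free_row k j R r - g r. x k - z r (Suc c))"
      by (rule prod.cong) (auto simp: w)
    also have "(\<Prod>c\<in>g r. ?w (r, c)) = (\<Prod>c\<in>g r. x (Suc k) - z r c)"
      using sub by (intro prod.cong) (auto simp: w)
    finally show "(\<Prod>c\<in>free_row k j R r. ?w (r, c)) = (\<Prod>c\<in>g r. x (Suc k) - z r c) *
        (\<Prod>c\<in>free_row k j R r - g r. x k - z r (Suc c))" by (simp only: mult.commute)
  qed
  finally show ?thesis .
qed

text \<open>
  This replaces the Bender-Knuth involution. Taking \<open>j = 0\<close> gives the symmetry of the skew factorial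
  Schur function; larger \<open>j\<close> is needed for the cancellation of the terms that are not Yamanouchi.
\<close>

lemma sum_extensions_symmetric:
  fixes y :: "int \<Rightarrow> 'a :: comm_ring_1"
  assumes k: "1 \<le> k" "k < d" and bd: "boundary_paired k j T"
  defines "G \<equiv> \<lambda>x. \<Sum>R\<in>extensions j T. \<Prod>b\<in>{b \<in> D. j \<le> snd b}. box_weight d y x (R b) b"
  shows "G (x \<circ> transpose k (Suc k)) = G x"
proof -
  let ?w = "\<lambda>x R. \<Prod>b\<in>{b \<in> D. j \<le> snd b}. box_weight d y x (R b) b"
  let ?x = "x \<circ> transpose k (Suc k)"
  have fin: "finite (extensions j T)"
    by (rule finite_subset[of _ "fillings d mu kap"]) (auto simp: extensions_def)
  have class_sum: "(\<Sum>R' | R' \<in> extensions j T \<and> merge k j R' = merge k j R. ?w x R') =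
      (\<Prod>b\<in>{b \<in> D. j \<le> snd b} - free_boxes k j R. box_weight d y x (R b) b) *
      (\<Prod>r\<in>{1..d}. row_sum (free_row k j R r) (\<lambda>c. y (int d - int k + int c - int r)) (x (Suc k)) (x k))"
    if R: "R \<in> extensions j T" for R x
  proof -
    have bdR: "boundary_paired k j R"
      unfolding boundary_paired_def
    proof (intro allI impI)
      fix r c assume h: "Suc c = j" "(r, c) \<in> D" "R (r, c) = k"
      have eq: "R b = T b" if "b \<in> D" "snd b = c" for b
        using R that h(1) by (auto simp: extensions_def)
      then have "T (r, c) = k" using h by simp
      then obtain r' where r': "(r', c) \<in> D" "T (r', c) = Suc k"
        using bd h unfolding boundary_paired_def by blast
      then have "R (r', c) = Suc k" using eq by simp
      then show "\<exists>r'. (r', c) \<in> D \<and> R (r', c) = Suc k" using r' by blast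
    qed
    show ?thesis
      unfolding sum_merge_class[OF R bdR k] row_sum_def
      by (subst prod_sum_PiE)
        (auto simp: finite_lower_subsets prod_refill sum_distrib_left intro!: sum.cong)
  qed
  have "G x = (\<Sum>m\<in>merge k j ` extensions j T. \<Sum>R' | R' \<in> extensions j T \<and> merge k j R' = m. ?w x R')" for x
    unfolding G_def by (rule sum.image_gen[OF fin])
  moreover have "(\<Sum>R' | R' \<in> extensions j T \<and> merge k j R' = m. ?w ?x R') =
      (\<Sum>R' | R' \<in> extensions j T \<and> merge k j R' = m. ?w x R')"
    if "m \<in> merge k j ` extensions j T" for m
  proof -
    from that obtain R where R: "R \<in> extensions j T" and m: "m = merge k j R" by blast
    have Rf: "R \<in> fillings d mu kap" using R by (simp add: extensions_def)
    have row: "row_sum (free_row k j R r) z p q = row_sum (free_row k j R r) z q p"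
      for r and z :: "nat \<Rightarrow> 'a" and p q
      by (rule row_sum_commute[OF finite_free_row free_row_convex[OF Rf]])
    show ?thesis
      unfolding m class_sum[OF R] prod_fixed_boxes_symmetric[OF Rf]
      by (subst row) simp
  qed
  ultimately show ?thesis by simp
qed

lemma skew_factorial_schur_eq:
  "skew_factorial_schur d mu kap x y =
    (\<Sum>R\<in>fillings d mu kap. \<Prod>b\<in>D. box_weight d y x (R b) b)"
  by (simp add: skew_factorial_schur_def box_weight_def case_prod_beta)

lemma skew_factorial_schur_symmetric:
  assumes p: "p permutes {1..d}"
  shows "skew_factorial_schur d mu kap (x \<circ> p) y = skew_factorial_schur d mu kap x y"
proof (rule symmetric_from_adjacent[OF _ p])
  fix k x assume k: "1 \<le> k" "k < d"
  have "boundary_paired k 0 T" for T by (simp add: boundary_paired_def)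
  from sum_extensions_symmetric[OF k this]
  show "skew_factorial_schur d mu kap (x \<circ> transpose k (Suc k)) y = skew_factorial_schur d mu kap x y"
    by (simp add: skew_factorial_schur_eq extensions_def)
qed

end

section \<open>Expansion of the product into barred fillings\<close>

definition factorial_monomial ::
  "nat \<Rightarrow> (nat \<Rightarrow> nat) \<Rightarrow> (int \<Rightarrow> 'a) \<Rightarrow> (nat \<Rightarrow> 'a) \<Rightarrow> 'a :: comm_ring_1" where
  "factorial_monomial d al y x = (\<Prod>i\<in>{1..d}. \<Prod>m\<in>{1..al i}. x i - y (int m))"

definition alternant ::
  "nat \<Rightarrow> (nat \<Rightarrow> nat) \<Rightarrow> (int \<Rightarrow> 'a) \<Rightarrow> (nat \<Rightarrow> 'a) \<Rightarrow> 'a :: comm_ring_1" where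
  "alternant d lam y x = alternate d (factorial_monomial d (\<lambda>i. lam i + (d - i)) y) x"

text \<open>
  The factor that prolongs \<open>(x\<^sub>i - y\<^sub>1) \<dots> (x\<^sub>i - y\<^sub>\<alpha>)\<close> is \<open>x\<^sub>i\<close> minus the next \<open>y\<close>; this is why the
  coefficients of the theorem contain \<open>y\<close> at an index that counts earlier entries.
\<close>

lemma factorial_monomial_increment:
  fixes y :: "int \<Rightarrow> 'a :: comm_ring_1" and R :: "'b \<Rightarrow> nat"
  assumes inj: "inj_on R V" and sub: "R ` V \<subseteq> {1..d}"
  shows "factorial_monomial d (\<lambda>i. al i + (if i \<in> R ` V then 1 else 0)) y x =
    factorial_monomial d al y x * (\<Prod>b\<in>V. x (R b) - y (int (al (R b)) + 1))"
proof -
  let ?h = "\<lambda>i. x i - y (int (al i) + 1)"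
  have "(\<Prod>m\<in>{1..al i + (if i \<in> R ` V then 1 else 0)}. x i - y (int m)) =
      (\<Prod>m\<in>{1..al i}. x i - y (int m)) * (if i \<in> R ` V then ?h i else 1)" for i
    by (simp add: add.commute)
  then have "factorial_monomial d (\<lambda>i. al i + (if i \<in> R ` V then 1 else 0)) y x =
      factorial_monomial d al y x * (\<Prod>i\<in>{1..d}. if i \<in> R ` V then ?h i else 1)"
    unfolding factorial_monomial_def by (simp only: prod.distrib)
  also have "(\<Prod>i\<in>{1..d}. if i \<in> R ` V then ?h i else 1) = (\<Prod>i\<in>{1..d} \<inter> R ` V. ?h i)"
    by (rule prod.inter_restrict[symmetric]) simp
  also have "{1..d} \<inter> R ` V = R ` V" using sub by blast
  also have "(\<Prod>i\<in>R ` V. ?h i) = (\<Prod>b\<in>V. ?h (R b))"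
    by (rule prod.reindex[OF inj, unfolded o_def])
  finally show ?thesis .
qed

lemma factorial_monomial_transpose:
  assumes k: "1 \<le> k" "k < d" and eq: "al k = al (Suc k)"
  shows "factorial_monomial d al y (x \<circ> transpose k (Suc k)) = factorial_monomial d al y x"
proof -
  let ?t = "transpose k (Suc k)"
  have al: "al (?t i) = al i" for i using eq by (simp add: transpose_def)
  show ?thesis unfolding factorial_monomial_def
    by (rule prod.reindex_bij_witness[where i = ?t and j = ?t])
      (use k in \<open>auto simp: al, auto simp: transpose_def split: if_splits\<close>)
qed

context skew_shape
begin

text \<open>
  From here on a barred filling is a pair \<open>(R, S)\<close> of its underlying filling and its set of barred
  boxes.
\<close>

definition count_before ::
  "(nat \<times> nat \<Rightarrow> nat) \<Rightarrow> (nat \<times> nat) set \<Rightarrow> nat \<Rightarrow> nat \<Rightarrow> nat" where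
  "count_before R S c v = card {b \<in> D - S. snd b < c \<and> R b = v}"

text \<open>
  The factor of the coefficient \<open>c\<close> at a barred box. A value occurs at most once in a column, so of the
  unbarred entries read before a box those with the same value lie in strictly earlier columns; no
  reference to the order within a column is needed.
\<close>

definition bar_weight ::
  "(nat \<Rightarrow> nat) \<Rightarrow> (int \<Rightarrow> 'a) \<Rightarrow> (nat \<times> nat \<Rightarrow> nat) \<Rightarrow> (nat \<times> nat) set \<Rightarrow> nat \<times> nat \<Rightarrow> 'a :: comm_ring_1"
where
  "bar_weight lam y R S b =
     y (dual_index d (int (R b)) + int (lam (R b) + count_before R S (snd b) (R b)))
     - y (dual_index d (int (R b)) + int (snd b) - int (fst b))"

definition dominant_up_to ::
  "(nat \<Rightarrow> nat) \<Rightarrow> (nat \<times> nat \<Rightarrow> nat) \<Rightarrow> (nat \<times> nat) set \<Rightarrow> nat \<Rightarrow> bool" where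
  "dominant_up_to lam R S j \<longleftrightarrow> (\<forall>c\<le>j. \<forall>k. 1 \<le> k \<and> k < d \<longrightarrow>
     lam (Suc k) + count_before R S c (Suc k) \<le> lam k + count_before R S c k)"

text \<open>
  Intermediate stage of the expansion: the columns before \<open>j\<close> already carry bars and satisfy the
  Yamanouchi condition at the end of each column, the others still carry their full weights.
\<close>

definition hybrids :: "(nat \<Rightarrow> nat) \<Rightarrow> nat \<Rightarrow> ((nat \<times> nat \<Rightarrow> nat) \<times> (nat \<times> nat) set) set" where
  "hybrids lam j = {(R, S). R \<in> fillings d mu kap \<and> S \<subseteq> {b \<in> D. snd b < j} \<and> dominant_up_to lam R S j}"

definition hybrid_term ::
  "(nat \<Rightarrow> nat) \<Rightarrow> (int \<Rightarrow> 'a) \<Rightarrow> (nat \<Rightarrow> 'a) \<Rightarrow> nat \<Rightarrow>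
     (nat \<times> nat \<Rightarrow> nat) \<times> (nat \<times> nat) set \<Rightarrow> 'a :: comm_ring_1" where
  "hybrid_term lam y x j = (\<lambda>(R, S). (\<Prod>b\<in>S. bar_weight lam y R S b) *
     alternate d (\<lambda>x. factorial_monomial d (\<lambda>i. lam i + count_before R S j i + (d - i)) y x *
       (\<Prod>b\<in>{b \<in> D. j \<le> snd b}. box_weight d y x (R b) b)) x)"

definition column :: "nat \<Rightarrow> (nat \<times> nat) set" where
  "column j = {b \<in> D. snd b = j}"

lemma finite_column [simp]: "finite (column j)"
  by (simp add: column_def)

lemma inj_on_column: "R \<in> fillings d mu kap \<Longrightarrow> inj_on R (column j)"
  by (rule inj_onI) (auto simp: column_def dest: filling_column_inj)

lemma count_before_cong:
  assumes "\<And>b. b \<in> D \<Longrightarrow> snd b < c \<Longrightarrow> R b = R' b \<and> (b \<in> S \<longleftrightarrow> b \<in> S')"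
  shows "count_before R S c v = count_before R' S' c v"
  unfolding count_before_def by (rule arg_cong[of _ _ card]) (use assms in auto)

lemma count_before_Suc:
  assumes R: "R \<in> fillings d mu kap"
  shows "count_before R S (Suc j) v = count_before R S j v + (if v \<in> R ` (column j - S) then 1 else 0)"
proof -
  have "{b \<in> D - S. snd b < Suc j \<and> R b = v} =
      {b \<in> D - S. snd b < j \<and> R b = v} \<union> {b \<in> column j - S. R b = v}"
    by (auto simp: column_def less_Suc_eq)
  then have "count_before R S (Suc j) v = count_before R S j v + card {b \<in> column j - S. R b = v}"
    unfolding count_before_def by (simp, subst card_Un_disjoint) (auto simp: column_def)
  moreover have "card {b \<in> column j - S. R b = v} = (if v \<in> R ` (column j - S) then 1 else 0)"
  proof (cases "v \<in> R ` (column j - S)")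
    case True
    then obtain b where b: "b \<in> column j - S" "R b = v" by blast
    have "b' = b" if "b' \<in> column j - S" "R b' = v" for b'
      using inj_onD[OF inj_on_column[OF R, of j], of b' b] that b by simp
    then have "{b \<in> column j - S. R b = v} = {b}" using b by blast
    then show ?thesis using True by simp
  next
    case False
    then have "{b \<in> column j - S. R b = v} = {}" by blast
    then show ?thesis using False by simp
  qed
  ultimately show ?thesis by simp
qed

text \<open>
  Each factor \<open>x - y\<^sub>b\<close> of column \<open>j\<close> is split as \<open>(x - y\<^sub>n) + (y\<^sub>n - y\<^sub>b)\<close>, where \<open>y\<^sub>n\<close> is the
  variable that prolongs the factorial monomial. Choosing the second summand means putting a bar on the
  box. The entries of a column are distinct, so the choices do not influence each other.
\<close>

lemma expand_column:
  fixes y :: "int \<Rightarrow> 'a :: comm_ring_1"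
  assumes R: "R \<in> fillings d mu kap" and S: "S \<subseteq> {b \<in> D. snd b < j}"
  shows "factorial_monomial d (\<lambda>i. lam i + count_before R S j i + (d - i)) y x *
      (\<Prod>b\<in>{b \<in> D. j \<le> snd b}. box_weight d y x (R b) b) =
    (\<Sum>S'\<in>Pow (column j). (\<Prod>b\<in>S'. bar_weight lam y R (S \<union> S') b) *
      (factorial_monomial d (\<lambda>i. lam i + count_before R (S \<union> S') (Suc j) i + (d - i)) y x *
       (\<Prod>b\<in>{b \<in> D. Suc j \<le> snd b}. box_weight d y x (R b) b)))"
proof -
  \<comment> \<open>Since \<open>d - i + 1\<close> is the dual of \<open>i\<close>, the next index \<open>al i + 1\<close> is the one in the bar weight.\<close>
  define al where "al = (\<lambda>i. lam i + count_before R S j i + (d - i))"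
  let ?q = "\<lambda>b. x (R b) - y (int (al (R b)) + 1)"
  let ?rest = "\<Prod>b\<in>{b \<in> D. Suc j \<le> snd b}. box_weight d y x (R b) b"
  have "{b \<in> D. j \<le> snd b} = column j \<union> {b \<in> D. Suc j \<le> snd b}"
    by (auto simp: column_def)
  then have "(\<Prod>b\<in>{b \<in> D. j \<le> snd b}. box_weight d y x (R b) b) =
      (\<Prod>b\<in>column j. box_weight d y x (R b) b) * ?rest"
    by (simp only:) (subst prod.union_disjoint, auto simp: column_def)
  also have "(\<Prod>b\<in>column j. box_weight d y x (R b) b) = (\<Prod>b\<in>column j. bar_weight lam y R S b + ?q b)"
  proof (rule prod.cong[OF refl])
    fix b assume b: "b \<in> column j"
    then have "R b \<in> {1..d}" using filling_range[OF R] by (simp add: column_def)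
    then have "int (al (R b)) + 1 =
        dual_index d (int (R b)) + int (lam (R b) + count_before R S (snd b) (R b))"
      using b by (simp add: al_def dual_index_def column_def)
    then show "box_weight d y x (R b) b = bar_weight lam y R S b + ?q b"
      by (simp add: box_weight_def bar_weight_def)
  qed
  also have "\<dots> = (\<Sum>S'\<in>Pow (column j). (\<Prod>b\<in>S'. bar_weight lam y R S b) * (\<Prod>b\<in>column j - S'. ?q b))"
    by (rule prod_add) simp
  finally have "factorial_monomial d al y x * (\<Prod>b\<in>{b \<in> D. j \<le> snd b}. box_weight d y x (R b) b) =
      (\<Sum>S'\<in>Pow (column j). (\<Prod>b\<in>S'. bar_weight lam y R S b) *
        ((factorial_monomial d al y x * (\<Prod>b\<in>column j - S'. ?q b)) * ?rest))"
    by (simp add: sum_distrib_left sum_distrib_right mult_ac)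
  also have "\<dots> = (\<Sum>S'\<in>Pow (column j). (\<Prod>b\<in>S'. bar_weight lam y R (S \<union> S') b) *
      (factorial_monomial d (\<lambda>i. lam i + count_before R (S \<union> S') (Suc j) i + (d - i)) y x * ?rest))"
  proof (rule sum.cong[OF refl])
    fix S' assume S': "S' \<in> Pow (column j)"
    have cb: "count_before R S j = count_before R (S \<union> S') j"
      by (rule ext, rule count_before_cong) (use S' in \<open>auto simp: column_def\<close>)
    have "(\<Prod>b\<in>S'. bar_weight lam y R S b) = (\<Prod>b\<in>S'. bar_weight lam y R (S \<union> S') b)"
    proof (rule prod.cong[OF refl])
      fix b assume "b \<in> S'"
      then have "snd b = j" using S' by (auto simp: column_def)
      then show "bar_weight lam y R S b = bar_weight lam y R (S \<union> S') b"
        by (simp add: bar_weight_def cb)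
    qed
    moreover have diff: "column j - (S \<union> S') = column j - S'" using S by (auto simp: column_def)
    have "factorial_monomial d al y x * (\<Prod>b\<in>column j - S'. ?q b) =
        factorial_monomial d (\<lambda>i. al i + (if i \<in> R ` (column j - S') then 1 else 0)) y x"
      by (rule factorial_monomial_increment[symmetric])
        (use inj_on_column[OF R] filling_range[OF R] in \<open>auto simp: column_def intro: inj_on_subset\<close>)
    moreover have "(\<lambda>i. al i + (if i \<in> R ` (column j - S') then 1 else 0)) =
        (\<lambda>i. lam i + count_before R (S \<union> S') (Suc j) i + (d - i))"
      by (rule ext) (simp add: al_def count_before_Suc[OF R] cb diff)
    ultimately show "(\<Prod>b\<in>S'. bar_weight lam y R S b) *
        ((factorial_monomial d al y x * (\<Prod>b\<in>column j - S'. ?q b)) * ?rest) =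
      (\<Prod>b\<in>S'. bar_weight lam y R (S \<union> S') b) *
        (factorial_monomial d (\<lambda>i. lam i + count_before R (S \<union> S') (Suc j) i + (d - i)) y x * ?rest)"
      by simp
  qed
  finally show ?thesis unfolding al_def .
qed

lemma hybrid_term_expand:
  assumes R: "R \<in> fillings d mu kap" and S: "S \<subseteq> {b \<in> D. snd b < j}"
  shows "hybrid_term lam y x j (R, S) = (\<Sum>S'\<in>Pow (column j). hybrid_term lam y x (Suc j) (R, S \<union> S'))"
proof -
  have finS: "finite S" using S finite_subset[of S D] by auto
  have prods: "(\<Prod>b\<in>S \<union> S'. bar_weight lam y R (S \<union> S') b) =
      (\<Prod>b\<in>S. bar_weight lam y R S b) * (\<Prod>b\<in>S'. bar_weight lam y R (S \<union> S') b)"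
    if S': "S' \<in> Pow (column j)" for S'
  proof -
    have "bar_weight lam y R (S \<union> S') b = bar_weight lam y R S b" if "b \<in> S" for b
    proof -
      have "snd b < j" using S that by blast
      moreover have "snd b' = j" if "b' \<in> S'" for b' using S' that by (auto simp: column_def)
      ultimately have "count_before R (S \<union> S') (snd b) v = count_before R S (snd b) v" for v
        by (intro count_before_cong) auto
      then show ?thesis by (simp add: bar_weight_def)
    qed
    moreover have "finite S'" using S' finite_subset[OF _ finite_column] by blast
    moreover have "S \<inter> S' = {}" using S S' by (auto simp: column_def)
    ultimately show ?thesis using finS by (simp add: prod.union_disjoint)
  qed
  show ?thesis
    unfolding hybrid_term_def prod.case expand_column[OF R S] alternate_sum sum_distrib_left alternate_cmult
    by (rule sum.cong[OF refl]) (simp add: prods mult.assoc)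
qed

text \<open>
  The result of expanding column \<open>j\<close>, before the terms that violate the condition at its end are
  discarded.
\<close>

definition half_expanded ::
  "(nat \<Rightarrow> nat) \<Rightarrow> nat \<Rightarrow> ((nat \<times> nat \<Rightarrow> nat) \<times> (nat \<times> nat) set) set" where
  "half_expanded lam j =
     {(R, S). R \<in> fillings d mu kap \<and> S \<subseteq> {b \<in> D. snd b < Suc j} \<and> dominant_up_to lam R S j}"

lemma dominant_up_to_cong:
  assumes "\<And>b. b \<in> D \<Longrightarrow> snd b < j \<Longrightarrow> R b = R' b \<and> (b \<in> S \<longleftrightarrow> b \<in> S')"
  shows "dominant_up_to lam R S j \<longleftrightarrow> dominant_up_to lam R' S' j"
proof -
  have "count_before R S c v = count_before R' S' c v" if "c \<le> j" for c v
    by (rule count_before_cong) (use assms that in force)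
  then show ?thesis by (auto simp: dominant_up_to_def)
qed

lemma finite_half_expanded: "finite (half_expanded lam j)"
proof (rule finite_subset)
  show "half_expanded lam j \<subseteq> fillings d mu kap \<times> Pow D"
    by (auto simp: half_expanded_def)
qed simp

lemma finite_hybrids: "finite (hybrids lam j)"
proof (rule finite_subset)
  show "hybrids lam j \<subseteq> fillings d mu kap \<times> Pow D"
    by (auto simp: hybrids_def)
qed simp

lemma sum_hybrids_expand:
  "(\<Sum>p\<in>hybrids lam j. hybrid_term lam y x j p) = (\<Sum>p\<in>half_expanded lam j. hybrid_term lam y x (Suc j) p)"
proof -
  have "(\<Sum>p\<in>hybrids lam j. hybrid_term lam y x j p) =
      (\<Sum>p\<in>hybrids lam j. \<Sum>S'\<in>Pow (column j). hybrid_term lam y x (Suc j) (fst p, snd p \<union> S'))"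
    by (rule sum.cong[OF refl]) (auto simp: hybrids_def hybrid_term_expand)
  also have "\<dots> = (\<Sum>(p, S')\<in>hybrids lam j \<times> Pow (column j). hybrid_term lam y x (Suc j) (fst p, snd p \<union> S'))"
    by (rule sum.cartesian_product)
  also have "\<dots> = (\<Sum>p\<in>half_expanded lam j. hybrid_term lam y x (Suc j) p)"
  proof (rule sum.reindex_bij_witness[where
        i = "\<lambda>p. ((fst p, snd p - column j), snd p \<inter> column j)" and
        j = "\<lambda>q. (fst (fst q), snd (fst q) \<union> snd q)"])
    fix p assume "p \<in> hybrids lam j \<times> Pow (column j)"
    then obtain R S S' where p: "p = ((R, S), S')" and R: "R \<in> fillings d mu kap"
      and S: "S \<subseteq> {b \<in> D. snd b < j}" and S': "S' \<subseteq> column j" and dom: "dominant_up_to lam R S j"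
      by (auto simp: hybrids_def)
    have "(S \<union> S') - column j = S" "(S \<union> S') \<inter> column j = S'"
      using S S' by (auto simp: column_def)
    then show "((fst (fst (fst p), snd (fst p) \<union> snd p), snd (fst (fst p), snd (fst p) \<union> snd p) - column j),
        snd (fst (fst p), snd (fst p) \<union> snd p) \<inter> column j) = p" by (simp add: p)
    have "dominant_up_to lam R S j \<longleftrightarrow> dominant_up_to lam R (S \<union> S') j"
      by (rule dominant_up_to_cong) (use S' in \<open>auto simp: column_def\<close>)
    moreover have "S \<union> S' \<subseteq> {b \<in> D. snd b < Suc j}" using S S' by (auto simp: column_def)
    ultimately show "(fst (fst p), snd (fst p) \<union> snd p) \<in> half_expanded lam j"
      using R dom by (simp add: p half_expanded_def)
    show "hybrid_term lam y x (Suc j) (fst (fst p), snd (fst p) \<union> snd p) =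
        (case p of (p, S') \<Rightarrow> hybrid_term lam y x (Suc j) (fst p, snd p \<union> S'))" by (simp add: p)
  next
    fix p assume "p \<in> half_expanded lam j"
    then obtain R S where p: "p = (R, S)" and R: "R \<in> fillings d mu kap"
      and S: "S \<subseteq> {b \<in> D. snd b < Suc j}" and dom: "dominant_up_to lam R S j"
      by (auto simp: half_expanded_def)
    have un: "(S - column j) \<union> (S \<inter> column j) = S" by blast
    then show "(fst (fst ((fst p, snd p - column j), snd p \<inter> column j)),
        snd (fst ((fst p, snd p - column j), snd p \<inter> column j)) \<union>
        snd ((fst p, snd p - column j), snd p \<inter> column j)) = p" by (simp add: p)
    have "dominant_up_to lam R S j \<longleftrightarrow> dominant_up_to lam R (S - column j) j"
      by (rule dominant_up_to_cong) (auto simp: column_def)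
    moreover have "S - column j \<subseteq> {b \<in> D. snd b < j}" using S by (auto simp: column_def)
    ultimately show "((fst p, snd p - column j), snd p \<inter> column j) \<in> hybrids lam j \<times> Pow (column j)"
      using R dom by (simp add: p hybrids_def)
  qed
  finally show ?thesis .
qed

text \<open>
  If the condition first fails at the end of column \<open>j\<close>, for the letters \<open>k\<close> and \<open>k + 1\<close>, then it fails
  by exactly one, because a column adds at most one to each count. So column \<open>j\<close> contains an unbarred
  \<open>k + 1\<close>, and the exponents of the factorial monomial at \<open>k\<close> and \<open>k + 1\<close> coincide. With the bars and
  the columns up to \<open>j\<close> fixed, both the monomial and the sum over the remaining columns are then
  symmetric in the two variables, and the alternating sum vanishes.
\<close>

lemma sum_extensions_hybrid_term_0:
  assumes R: "R \<in> fillings d mu kap" and S: "S \<subseteq> {b \<in> D. snd b < Suc j}"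
    and dom: "dominant_up_to lam R S j" and k: "1 \<le> k" "k < d"
    and viol: "lam k + count_before R S (Suc j) k < lam (Suc k) + count_before R S (Suc j) (Suc k)"
  shows "(\<Sum>R'\<in>extensions (Suc j) R. hybrid_term lam y x (Suc j) (R', S)) = 0"
proof -
  let ?al = "\<lambda>i. lam i + count_before R S (Suc j) i + (d - i)"
  let ?G = "\<lambda>x. \<Sum>R'\<in>extensions (Suc j) R. \<Prod>b\<in>{b \<in> D. Suc j \<le> snd b}. box_weight d y x (R' b) b"
  have le: "lam (Suc k) + count_before R S j (Suc k) \<le> lam k + count_before R S j k"
    using dom k unfolding dominant_up_to_def by blast
  note cs = count_before_Suc[OF R, of S j]
  have out: "k \<notin> R ` (column j - S)" and inn: "Suc k \<in> R ` (column j - S)"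
    and eq: "lam k + count_before R S (Suc j) k + 1 = lam (Suc k) + count_before R S (Suc j) (Suc k)"
    using viol le unfolding cs by (auto split: if_splits)
  have al: "?al k = ?al (Suc k)" using eq k by simp
  have bd: "boundary_paired k (Suc j) R"
    using inn unfolding boundary_paired_def column_def by fastforce
  have agree: "R' b = R b" if "R' \<in> extensions (Suc j) R" "b \<in> D" "snd b < Suc j" for R' b
    using that by (simp add: extensions_def)
  have cnt: "count_before R' S c v = count_before R S c v"
    if "R' \<in> extensions (Suc j) R" "c \<le> Suc j" for R' c v
    by (rule count_before_cong) (use agree that in auto)
  have bw: "(\<Prod>b\<in>S. bar_weight lam y R' S b) = (\<Prod>b\<in>S. bar_weight lam y R S b)"
    if R': "R' \<in> extensions (Suc j) R" for R'
  proof (rule prod.cong[OF refl])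
    fix b assume "b \<in> S"
    then have "b \<in> D" "snd b < Suc j" using S by auto
    then show "bar_weight lam y R' S b = bar_weight lam y R S b"
      using agree[OF R'] cnt[OF R', of "snd b"] by (simp add: bar_weight_def)
  qed
  have "(\<Sum>R'\<in>extensions (Suc j) R. hybrid_term lam y x (Suc j) (R', S)) =
      (\<Prod>b\<in>S. bar_weight lam y R S b) * alternate d (\<lambda>x. factorial_monomial d ?al y x * ?G x) x"
    unfolding sum_distrib_left alternate_sum hybrid_term_def prod.case
    by (rule sum.cong[OF refl]) (simp add: bw cnt)
  also have "alternate d (\<lambda>x. factorial_monomial d ?al y x * ?G x) x = 0"
  proof (rule alternate_eq_0)
    show "factorial_monomial d ?al y (x \<circ> transpose k (Suc k)) * ?G (x \<circ> transpose k (Suc k)) =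
        factorial_monomial d ?al y x * ?G x" for x
      by (simp only: factorial_monomial_transpose[OF k al] sum_extensions_symmetric[OF k bd])
  qed (use k in auto)
  finally show ?thesis by simp
qed

lemma sum_hybrids_Suc:
  "(\<Sum>p\<in>hybrids lam j. hybrid_term lam y x j p) = (\<Sum>p\<in>hybrids lam (Suc j). hybrid_term lam y x (Suc j) p)"
proof -
  define bad where "bad = half_expanded lam j - hybrids lam (Suc j)"
  let ?key = "\<lambda>(R, S). (restrict R {b \<in> D. snd b < Suc j}, S)"
  have sub: "hybrids lam (Suc j) \<subseteq> half_expanded lam j"
    by (auto simp: hybrids_def half_expanded_def dominant_up_to_def)
  have fin: "finite bad" by (simp add: bad_def finite_half_expanded)
  have bad_iff: "(R, S) \<in> bad \<longleftrightarrow> R \<in> fillings d mu kap \<and> S \<subseteq> {b \<in> D. snd b < Suc j} \<and>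
      dominant_up_to lam R S j \<and> \<not> dominant_up_to lam R S (Suc j)" for R S
    by (auto simp: bad_def hybrids_def half_expanded_def)
  have "(\<Sum>p\<in>bad. hybrid_term lam y x (Suc j) p) =
      (\<Sum>q\<in>?key ` bad. \<Sum>p | p \<in> bad \<and> ?key p = q. hybrid_term lam y x (Suc j) p)"
    by (rule sum.image_gen[OF fin])
  also have "\<dots> = 0"
  proof (rule sum.neutral, rule ballI)
    fix q assume "q \<in> ?key ` bad"
    then obtain R S where b: "(R, S) \<in> bad" and q: "q = (restrict R {b \<in> D. snd b < Suc j}, S)"
      by auto
    note bd = b[unfolded bad_iff]
    have fibre: "{p. p \<in> bad \<and> ?key p = q} = (\<lambda>R'. (R', S)) ` extensions (Suc j) R"
    proof (intro set_eqI iffI)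
      fix p assume "p \<in> {p. p \<in> bad \<and> ?key p = q}"
      then obtain R' where p: "p = (R', S)" and R': "(R', S) \<in> bad"
        and eq: "restrict R' {b \<in> D. snd b < Suc j} = restrict R {b \<in> D. snd b < Suc j}"
        by (cases p) (auto simp: q)
      have "R' b = R b" if "b \<in> D" "snd b < Suc j" for b
        using fun_cong[OF eq, of b] that by simp
      then have "R' \<in> extensions (Suc j) R" using R' by (simp add: bad_iff extensions_def)
      then show "p \<in> (\<lambda>R'. (R', S)) ` extensions (Suc j) R" by (simp add: p)
    next
      fix p assume "p \<in> (\<lambda>R'. (R', S)) ` extensions (Suc j) R"
      then obtain R' where p: "p = (R', S)" and R': "R' \<in> extensions (Suc j) R" by blast
      have agree: "R' b = R b" if "b \<in> D" "snd b < Suc j" for b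
        using R' that by (simp add: extensions_def)
      have "dominant_up_to lam R' S c \<longleftrightarrow> dominant_up_to lam R S c" if "c \<le> Suc j" for c
        by (rule dominant_up_to_cong) (use agree that in auto)
      then have "(R', S) \<in> bad" using bd R' by (simp add: bad_iff extensions_def)
      moreover have "restrict R' {b \<in> D. snd b < Suc j} = restrict R {b \<in> D. snd b < Suc j}"
        by (rule restrict_ext) (simp add: agree)
      ultimately show "p \<in> {p. p \<in> bad \<and> ?key p = q}" by (simp add: p q)
    qed
    obtain k where k: "1 \<le> k" "k < d"
      "lam k + count_before R S (Suc j) k < lam (Suc k) + count_before R S (Suc j) (Suc k)"
      using bd unfolding dominant_up_to_def by (metis le_Suc_eq not_le)
    show "(\<Sum>p | p \<in> bad \<and> ?key p = q. hybrid_term lam y x (Suc j) p) = 0"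
      unfolding fibre using bd sum_extensions_hybrid_term_0[of R S j lam k y x] k
      by (subst sum.reindex) (auto simp: inj_on_def)
  qed
  finally have bad0: "(\<Sum>p\<in>bad. hybrid_term lam y x (Suc j) p) = 0" .
  have "(\<Sum>p\<in>half_expanded lam j. hybrid_term lam y x (Suc j) p) =
      (\<Sum>p\<in>bad. hybrid_term lam y x (Suc j) p) + (\<Sum>p\<in>hybrids lam (Suc j). hybrid_term lam y x (Suc j) p)"
    unfolding bad_def by (rule sum.subset_diff[OF sub finite_half_expanded])
  then show ?thesis by (simp add: bad0 sum_hybrids_expand)
qed

text \<open>
  The theorem with alternants in place of factorial Schur functions: before the first column nothing
  is expanded, after the last one everything is.
\<close>

lemma alternant_times_skew_factorial_schur:
  assumes lam: "lam \<in> partitions d"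
  shows "alternant d lam y x * skew_factorial_schur d mu kap x y =
    (\<Sum>(R, S)\<in>hybrids lam (Suc (mu 1)). (\<Prod>b\<in>S. bar_weight lam y R S b) *
       alternant d (\<lambda>i. lam i + count_before R S (Suc (mu 1)) i) y x)"
proof -
  have c0: "count_before R S 0 v = 0" for R S v by (simp add: count_before_def)
  have "hybrids lam 0 = (\<lambda>R. (R, {})) ` fillings d mu kap"
    using lam by (auto simp: hybrids_def dominant_up_to_def c0 partitions_def)
  then have "(\<Sum>p\<in>hybrids lam 0. hybrid_term lam y x 0 p) =
      (\<Sum>R\<in>fillings d mu kap. hybrid_term lam y x 0 (R, {}))"
    by (simp add: sum.reindex inj_on_def)
  also have "\<dots> = alternate d (\<lambda>x. factorial_monomial d (\<lambda>i. lam i + (d - i)) y x *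
      skew_factorial_schur d mu kap x y) x"
    by (simp add: hybrid_term_def c0 skew_factorial_schur_eq sum_distrib_left alternate_sum)
  also have "\<dots> = alternant d lam y x * skew_factorial_schur d mu kap x y"
    unfolding alternant_def by (rule alternate_mult_symmetric) (rule skew_factorial_schur_symmetric)
  finally have start: "(\<Sum>p\<in>hybrids lam 0. hybrid_term lam y x 0 p) =
      alternant d lam y x * skew_factorial_schur d mu kap x y" .
  have "(\<Sum>p\<in>hybrids lam 0. hybrid_term lam y x 0 p) = (\<Sum>p\<in>hybrids lam j. hybrid_term lam y x j p)" for j
    by (induction j) (simp_all only: sum_hybrids_Suc[symmetric])
  note this[of "Suc (mu 1)"]
  also have "(\<Sum>p\<in>hybrids lam (Suc (mu 1)). hybrid_term lam y x (Suc (mu 1)) p) =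
      (\<Sum>(R, S)\<in>hybrids lam (Suc (mu 1)). (\<Prod>b\<in>S. bar_weight lam y R S b) *
       alternant d (\<lambda>i. lam i + count_before R S (Suc (mu 1)) i) y x)"
  proof -
    have "{b \<in> D. Suc (mu 1) \<le> snd b} = {}" using column_le_mu1 by fastforce
    then show ?thesis
      unfolding hybrid_term_def alternant_def by (simp only: prod.empty mult_1_right)
  qed
  finally show ?thesis unfolding start .
qed

end

section \<open>The bialternant formula\<close>

lemma alternant_cong:
  assumes "\<And>i. i \<in> {1..d} \<Longrightarrow> lam i = lam' i"
  shows "alternant d lam y x = alternant d lam' y x"
proof -
  have "factorial_monomial d (\<lambda>i. lam i + (d - i)) y x = factorial_monomial d (\<lambda>i. lam' i + (d - i)) y x" for x
    unfolding factorial_monomial_def by (rule prod.cong[OF refl]) (simp only: assms)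
  then show ?thesis unfolding alternant_def by (rule alternate_cong)
qed

lemma empty_partition_apply: "empty_partition i = 0"
  by (simp add: empty_partition_def)

lemma empty_partition_in_partitions: "empty_partition \<in> partitions d"
  by (simp add: partitions_def empty_partition_apply)

locale straight_shape = skew_shape d mu empty_partition for d mu
begin

definition height :: "nat \<Rightarrow> nat" where
  "height c = card {r \<in> {1..d}. c \<le> mu r}"

lemma le_height_iff: "1 \<le> r \<Longrightarrow> r \<le> height c \<longleftrightarrow> r \<le> d \<and> c \<le> mu r"
proof -
  assume r: "1 \<le> r"
  let ?X = "{r \<in> {1..d}. c \<le> mu r}"
  have down: "{1..r} \<subseteq> ?X" if "r \<le> d" "c \<le> mu r" for r
    using partitions_antimono[OF mu] that by fastforce
  show ?thesis
  proof
    assume "r \<le> d \<and> c \<le> mu r"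
    then have "card {1..r} \<le> height c" unfolding height_def by (intro card_mono down) auto
    then show "r \<le> height c" by simp
  next
    assume le: "r \<le> height c"
    show "r \<le> d \<and> c \<le> mu r"
    proof (rule ccontr)
      assume neg: "\<not> (r \<le> d \<and> c \<le> mu r)"
      have "?X \<subseteq> {1..<r}"
      proof
        fix s assume s: "s \<in> ?X"
        then have "{1..s} \<subseteq> ?X" using down[of s] by simp
        moreover have "r \<notin> ?X" using neg by simp
        ultimately have "r \<notin> {1..s}" by blast
        then have "\<not> r \<le> s" using r by simp
        then show "s \<in> {1..<r}" using s by simp
      qed
      then have "height c \<le> card {1..<r}" unfolding height_def by (intro card_mono) auto
      then show False using le r by simp
    qed
  qed
qed

lemma D_iff_height: "(r, c) \<in> D \<longleftrightarrow> 1 \<le> r \<and> 1 \<le> c \<and> r \<le> height c"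
  using le_height_iff[of r c] by (auto simp: D_iff empty_partition_apply)

lemma column_0: "column 0 = {}"
  by (auto simp: column_def D_iff)

lemma count_before_Suc_le:
  assumes R: "R \<in> fillings d mu empty_partition"
  shows "count_before R S (Suc n) v \<le> n"
proof (induction n)
  case 0
  then show ?case by (simp add: count_before_Suc[OF R] column_0) (simp add: count_before_def)
next
  case (Suc n)
  then show ?case by (subst count_before_Suc[OF R]) simp
qed

lemma count_before_full:
  assumes R: "R \<in> fillings d mu empty_partition"
    and full: "\<And>c. 1 \<le> c \<Longrightarrow> c \<le> n \<Longrightarrow> v \<in> R ` (column c - S)"
  shows "count_before R S (Suc n) v = n"
  using full
proof (induction n)
  case 0
  then show ?case using count_before_Suc_le[OF R, of S 0 v] by simp
next
  case (Suc n)
  then have "v \<in> R ` (column (Suc n) - S)" "count_before R S (Suc n) v = n" by simp_all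
  then show ?case by (subst count_before_Suc[OF R]) simp
qed

text \<open>
  In the expansion of \<open>s\<^sub>\<mu>\<close> times the alternant of the empty partition only one term survives, in which
  column \<open>c\<close> reads \<open>1, \<dots>, height c\<close> without bars. Indeed, if the earlier columns have this form, the
  value \<open>v\<close> of the bottom box of column \<open>c\<close> has occurred in all of them, and a bar on that box would
  give the factor \<open>y - y = 0\<close>. So \<open>v\<close> is unbarred, and dominance forces \<open>v - 1, \<dots>, 1\<close> to be
  unbarred entries of column \<open>c\<close>, too.
\<close>

lemma canonical_columns:
  fixes y :: "int \<Rightarrow> 'a :: comm_ring_1"
  assumes R: "R \<in> fillings d mu empty_partition" and S: "S \<subseteq> D"
    and dom: "dominant_up_to empty_partition R S (Suc (mu 1))"
    and nz: "(\<Prod>b\<in>S. bar_weight empty_partition y R S b) \<noteq> 0"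
    and c: "1 \<le> c" "c \<le> mu 1"
  shows "\<forall>r. (r, c) \<in> D \<longrightarrow> (r, c) \<notin> S \<and> R (r, c) + r = height c + 1"
  using c
proof (induction c rule: less_induct)
  case (less c)
  let ?v = "R (1, c)"
  have d1: "1 \<le> d"
  proof (rule ccontr)
    assume "\<not> 1 \<le> d"
    then have "mu 1 = 0" using mu by (simp add: partitions_def)
    then show False using less.prems by simp
  qed
  have D1: "(1, c') \<in> D" if "1 \<le> c'" "c' \<le> c" for c'
    using that less.prems d1 by (simp add: D_iff empty_partition_apply)
  have D1c: "(1, c) \<in> D" using D1 less.prems by simp
  have v: "1 \<le> ?v" "?v \<le> d" using filling_range[OF R D1c] by auto
  have prev: "u \<in> R ` (column c' - S)" if c': "1 \<le> c'" "c' < c" and u: "1 \<le> u" "u \<le> height c'" for c' u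
  proof -
    have "(height c' + 1 - u, c') \<in> D" using c' u by (simp add: D_iff_height) arith
    moreover from this have "(height c' + 1 - u, c') \<notin> S \<and> R (height c' + 1 - u, c') = u"
      using less.IH[of c'] c' less.prems u by fastforce
    ultimately show ?thesis by (force simp: column_def image_iff)
  qed
  have "?v \<in> R ` (column c' - S)" if "1 \<le> c'" "c' < c" for c'
  proof (rule prev[OF that v(1)])
    have "?v \<le> R (1, c')" using filling_row[OF R D1[of c'] D1c] that by simp
    moreover have "R (1, c') = height c'"
    proof -
      have "c' \<le> mu 1" "(1, c') \<in> D" using that less.prems D1[of c'] by simp_all
      then have "R (1, c') + 1 = height c' + 1" using less.IH[of c'] that by blast
      then show ?thesis by simp
    qed
    ultimately show "?v \<le> height c'" by simp
  qed
  then have "count_before R S (Suc (c - 1)) ?v = c - 1"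
    using less.prems by (intro count_before_full[OF R]) auto
  then have cnt: "count_before R S c ?v = c - 1" using less.prems by simp
  have notS: "(1, c) \<notin> S"
  proof
    assume inS: "(1, c) \<in> S"
    have "bar_weight empty_partition y R S (1, c) = 0"
      using less.prems(1) cnt by (simp add: bar_weight_def empty_partition_apply of_nat_diff algebra_simps)
    moreover have "finite S" using S finite_D by (rule finite_subset)
    ultimately have "(\<Prod>b\<in>S. bar_weight empty_partition y R S b) = 0"
      using inS by (intro prod_zero) auto
    with nz show False by simp
  qed
  have "?v \<in> R ` (column c - S)" using D1c notS by (auto simp: column_def)
  then have cntv: "count_before R S (Suc c) ?v = c"
    using cnt less.prems by (simp add: count_before_Suc[OF R])
  have ge: "c \<le> count_before R S (Suc c) u" if u: "1 \<le> u" "u \<le> ?v" for u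
    using u(2,1)
  proof (induction rule: inc_induct)
    case base
    then show ?case using cntv by simp
  next
    case (step n)
    then have n: "1 \<le> n" "n < d" using v by auto
    have "count_before R S (Suc c) (Suc n) \<le> count_before R S (Suc c) n"
      using dom n less.prems unfolding dominant_up_to_def empty_partition_apply by fastforce
    then show ?case using step by simp
  qed
  have all: "u \<in> R ` (column c - S)" if u: "1 \<le> u" "u \<le> ?v" for u
  proof -
    have "count_before R S (Suc (c - 1)) u \<le> c - 1" by (rule count_before_Suc_le[OF R])
    then have "count_before R S c u < c" using less.prems by simp
    then show ?thesis using ge[OF u] unfolding count_before_Suc[OF R] by (auto split: if_splits)
  qed
  have Dr: "(r, c) \<in> D \<longleftrightarrow> 1 \<le> r \<and> r \<le> height c" for r using less.prems by (simp add: D_iff_height)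
  have anti: "R (s, c) + s \<le> R (r, c) + r" if "1 \<le> r" "r \<le> s" "s \<le> height c" for r s
    using that(2,3)
  proof (induction rule: dec_induct)
    case (step n)
    have "R (Suc n, c) < R (n, c)"
      by (rule filling_column[OF R]) (use step that(1) in \<open>auto simp: Dr\<close>)
    then show ?case using step by simp
  qed simp
  have h1: "1 \<le> height c" using D1c by (simp add: Dr)
  have val_le: "R (r, c) \<le> ?v" if "(r, c) \<in> D" for r
    using anti[of 1 r] that by (simp add: Dr)
  have val_ge: "1 \<le> R (r, c)" if "(r, c) \<in> D" for r
    using filling_range[OF R that] by simp
  have col: "column c = (\<lambda>r. (r, c)) ` {1..height c}"
    by (auto simp: column_def Dr)
  have img: "R ` column c = {1..?v}"
    using all val_le val_ge by (fastforce simp: column_def)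
  have "card (R ` column c) = card (column c)" by (rule card_image[OF inj_on_column[OF R]])
  also have "card (column c) = height c" unfolding col by (subst card_image) (auto simp: inj_on_def)
  finally have hv: "height c = ?v" using img by simp
  show ?case
  proof (intro allI impI conjI)
    fix r assume r: "(r, c) \<in> D"
    have "R (r, c) \<in> R ` (column c - S)" using all val_le[OF r] val_ge[OF r] by blast
    then obtain b where b: "b \<in> column c - S" "R b = R (r, c)" by force
    have "(r, c) \<in> column c" using r by (simp add: column_def)
    then have "b = (r, c)" using inj_onD[OF inj_on_column[OF R, of c] b(2)] b(1) by simp
    then show "(r, c) \<notin> S" using b by simp
    have "R (height c, c) + height c \<le> R (r, c) + r" "R (r, c) + r \<le> ?v + 1"
      using anti[of r "height c"] anti[of 1 r] r by (auto simp: Dr)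
    moreover have "1 \<le> R (height c, c)" using val_ge h1 by (simp add: Dr)
    ultimately show "R (r, c) + r = height c + 1" using hv by simp
  qed
qed

definition canonical :: "nat \<times> nat \<Rightarrow> nat" where
  "canonical = (\<lambda>(r, c)\<in>D. height c + 1 - r)"

lemma canonical_in_fillings: "canonical \<in> fillings d mu empty_partition"
proof -
  have le_d: "height c \<le> d" for c
  proof -
    have "height c \<le> card {1..d}" unfolding height_def by (rule card_mono) auto
    then show ?thesis by simp
  qed
  have anti: "height c' \<le> height c" if "c \<le> c'" for c c'
    unfolding height_def by (rule card_mono) (use that in auto)
  have "canonical \<in> D \<rightarrow>\<^sub>E {1..d}"
  proof (rule PiE_I)
    fix b assume b: "b \<in> D"
    obtain r c where rc: "b = (r, c)" by (cases b)
    have "1 \<le> r" "r \<le> height c" using b rc by (simp_all add: D_iff_height)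
    then show "canonical b \<in> {1..d}" using b rc le_d[of c] by (simp add: canonical_def) arith
  qed (simp add: canonical_def)
  moreover have "semistandard D canonical"
    unfolding semistandard_def
  proof (intro conjI allI impI)
    fix r c c' assume a: "(r, c) \<in> D \<and> (r, c') \<in> D \<and> c < c'"
    then show "canonical (r, c') \<le> canonical (r, c)"
      using anti[of c c'] by (simp add: canonical_def)
  next
    fix r r' c assume a: "(r, c) \<in> D \<and> (r', c) \<in> D \<and> r < r'"
    then have "r' \<le> height c" by (simp add: D_iff_height)
    then show "canonical (r', c) < canonical (r, c)" using a by (simp add: canonical_def) arith
  qed
  ultimately show ?thesis by (simp add: fillings_def)
qed

lemma canonical_image_column:
  assumes v: "v \<in> {1..d}"
  shows "v \<in> canonical ` column c \<longleftrightarrow> 1 \<le> c \<and> c \<le> mu v"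
proof
  assume "v \<in> canonical ` column c"
  then obtain r where r: "(r, c) \<in> D" "v = height c + 1 - r"
    by (auto simp: column_def canonical_def)
  then have "1 \<le> c" "v \<le> height c" "1 \<le> v" using v by (auto simp: D_iff_height)
  then show "1 \<le> c \<and> c \<le> mu v" using le_height_iff[of v c] by simp
next
  assume a: "1 \<le> c \<and> c \<le> mu v"
  then have h: "v \<le> height c" using v le_height_iff[of v c] by simp
  then have "(height c + 1 - v, c) \<in> D" using a v by (simp add: D_iff_height) arith
  then show "v \<in> canonical ` column c"
    using h v by (intro image_eqI[of _ _ "(height c + 1 - v, c)"]) (auto simp: canonical_def column_def)
qed

lemma count_before_canonical:
  assumes v: "v \<in> {1..d}"
  shows "count_before canonical {} c v = min (c - 1) (mu v)"
proof (induction c)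
  case 0
  then show ?case by (simp add: count_before_def)
next
  case (Suc c)
  show ?case
    unfolding count_before_Suc[OF canonical_in_fillings] Suc.IH Diff_empty canonical_image_column[OF v]
    by auto
qed

lemma canonical_hybrid: "(canonical, {}) \<in> hybrids empty_partition j"
proof -
  have "mu (Suc k) \<le> mu k" if "1 \<le> k" "k < d" for k
    using partitions_antimono[OF mu, of k "Suc k"] that by simp
  then have "min (c - 1) (mu (Suc k)) \<le> min (c - 1) (mu k)" if "1 \<le> k" "k < d" for c k
    using that by (meson min.mono order_refl)
  then show ?thesis
    by (simp add: hybrids_def canonical_in_fillings dominant_up_to_def count_before_canonical
        empty_partition_apply)
qed

text \<open>
  This is the bialternant formula: a factorial Schur function is a quotient of alternants.
\<close>

lemma alternant_times_factorial_schur: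
  fixes y :: "int \<Rightarrow> 'a :: comm_ring_1"
  shows "alternant d empty_partition y x * factorial_schur d mu x y = alternant d mu y x"
proof -
  let ?H = "hybrids empty_partition (Suc (mu 1))"
  let ?f = "\<lambda>(R, S). (\<Prod>b\<in>S. bar_weight empty_partition y R S b) *
       alternant d (\<lambda>i. empty_partition i + count_before R S (Suc (mu 1)) i) y x"
  have zero: "?f p = 0" if p: "p \<in> ?H - {(canonical, {})}" for p
  proof (rule ccontr)
    assume nz: "?f p \<noteq> 0"
    obtain R S where RS: "p = (R, S)" by (cases p)
    have R: "R \<in> fillings d mu empty_partition" and S: "S \<subseteq> D"
      and dom: "dominant_up_to empty_partition R S (Suc (mu 1))"
      using p by (auto simp: hybrids_def RS)
    have "(\<Prod>b\<in>S. bar_weight empty_partition y R S b) \<noteq> 0" using nz by (auto simp: RS)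
    note can = canonical_columns[OF R S dom this]
    have box: "b \<notin> S \<and> R b = canonical b" if b: "b \<in> D" for b
    proof -
      obtain r c where rc: "b = (r, c)" by (cases b)
      have "1 \<le> c" "c \<le> mu 1" using b rc column_le_mu1 by (auto simp: D_iff)
      from can[OF this] b rc have "(r, c) \<notin> S" "R (r, c) + r = height c + 1" by auto
      then show ?thesis using b rc by (simp add: canonical_def)
    qed
    then have "S = {}" using S by blast
    moreover have "R = canonical"
      using box filling_outside[OF R] filling_outside[OF canonical_in_fillings] by (metis ext)
    ultimately show False using p RS by simp
  qed
  have "alternant d empty_partition y x * factorial_schur d mu x y = sum ?f ?H"
    unfolding factorial_schur_def
    by (rule alternant_times_skew_factorial_schur) (rule empty_partition_in_partitions)
  also have "\<dots> = sum ?f {(canonical, {})}"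
    by (rule sum.mono_neutral_right) (use zero canonical_hybrid finite_hybrids in blast)+
  also have "\<dots> = alternant d (\<lambda>i. empty_partition i + count_before canonical {} (Suc (mu 1)) i) y x"
    by simp
  also have "\<dots> = alternant d mu y x"
  proof (rule alternant_cong)
    fix i assume i: "i \<in> {1..d}"
    then have "mu i \<le> mu 1" using partitions_antimono[OF mu, of 1 i] by simp
    then show "empty_partition i + count_before canonical {} (Suc (mu 1)) i = mu i"
      using count_before_canonical[OF i] by (simp add: empty_partition_apply)
  qed
  finally show ?thesis .
qed

end

lemma alternant_eq:
  assumes "mu \<in> partitions d"
  shows "alternant d mu y x = alternant d empty_partition y x * factorial_schur d mu x y"
proof -
  interpret straight_shape d mu
    by standard (fact assms, fact empty_partition_in_partitions)
  show ?thesis by (rule alternant_times_factorial_schur[symmetric])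
qed

section \<open>Column words\<close>

text \<open>
  In an increasing column \<open>k\<close> is read before \<open>k + 1\<close>. Hence a violation inside the column, which arises
  on reading \<open>k + 1\<close>, persists to the end of the column, and it suffices to test there.
\<close>

lemma yamanouchi_append_column:
  assumes u: "sorted_wrt (<) u"
  shows "yamanouchi d (w @ u) \<longleftrightarrow> yamanouchi d w \<and>
    (\<forall>k. 1 \<le> k \<and> k < d \<longrightarrow> content (w @ u) (Suc k) \<le> content (w @ u) k)" (is "?L \<longleftrightarrow> ?R")
proof
  assume L: ?L
  have "content (take n w) (Suc k) \<le> content (take n w) k" if "n \<le> length w" "1 \<le> k" "k < d" for n k
    using L[unfolded yamanouchi_def, rule_format, of n k] that by simp
  moreover have "content (w @ u) (Suc k) \<le> content (w @ u) k" if "1 \<le> k" "k < d" for k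
    using L[unfolded yamanouchi_def, rule_format, of "length (w @ u)" k] that by simp
  ultimately show ?R by (simp add: yamanouchi_def)
next
  assume R: ?R
  show ?L unfolding yamanouchi_def
  proof (intro allI impI)
    fix n k assume n: "n \<le> length (w @ u)" and k: "1 \<le> k \<and> k < d"
    have w: "content (take m w) (Suc k) \<le> content (take m w) k" if "m \<le> length w" for m
      using R k that unfolding yamanouchi_def by blast
    show "content (take n (w @ u)) (Suc k) \<le> content (take n (w @ u)) k"
    proof (cases "n \<le> length w")
      case True
      then show ?thesis using w by simp
    next
      case False
      define a b where "a = take (n - length w) u" and "b = drop (n - length w) u"
      have tk: "take n (w @ u) = w @ a" using False by (simp add: a_def)
      have ab: "u = a @ b" by (simp add: a_def b_def)
      show ?thesis
      proof (cases "Suc k \<in> set a")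
        case True
        have "k \<notin> set b" using True u unfolding ab sorted_wrt_append by fastforce
        then have "count_list b k = 0" by (simp add: count_notin)
        moreover have "content (w @ u) (Suc k) \<le> content (w @ u) k" using R k by blast
        ultimately show ?thesis unfolding tk by (simp add: content_def ab)
      next
        case False
        then have "count_list a (Suc k) = 0" by (simp add: count_notin)
        then show ?thesis using w[of "length w"] unfolding tk by (simp add: content_def)
      qed
    qed
  qed
qed

lemma content_append: "content (u @ w) k = content u k + content w k"
  by (simp add: content_def)

lemma content_map_filter:
  assumes "distinct bs"
  shows "content (map f (filter P bs)) v = card {b \<in> set bs. P b \<and> f b = v}"
proof -
  have "content (map f (filter P bs)) v = length (filter (\<lambda>b. P b \<and> f b = v) bs)"
    unfolding content_def by (induction bs) auto
  also have "\<dots> = card (set (filter (\<lambda>b. P b \<and> f b = v) bs))"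
    using assms by (intro distinct_card[symmetric]) simp
  finally show ?thesis by simp
qed

lemma tableau_word_suffix:
  assumes lam: "lam \<in> partitions d" and "1 \<le> m" "m \<le> Suc (lam 1)"
  defines "W \<equiv> \<lambda>m. concat (map (\<lambda>j. filter (\<lambda>i. j \<le> lam i) [1..<Suc d]) (rev [m..<Suc (lam 1)]))"
  shows "yamanouchi d (W m) \<and> (\<forall>v\<in>{1..d}. content (W m) v = Suc (lam v) - m)"
  using assms(3,2)
proof (induction rule: inc_induct)
  case base
  have "lam v \<le> lam 1" if "v \<in> {1..d}" for v
    using partitions_antimono[OF lam, of 1 v] that by simp
  then show ?case by (simp add: W_def yamanouchi_def content_def)
next
  case (step m)
  let ?u = "filter (\<lambda>i. m \<le> lam i) [1..<Suc d]"
  have "[m..<Suc (lam 1)] = m # [Suc m..<Suc (lam 1)]"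
    using step.hyps by (intro upt_conv_Cons) simp
  then have W: "W m = W (Suc m) @ ?u" by (simp add: W_def del: upt_Suc)
  have "content ?u v = card {i \<in> set [1..<Suc d]. m \<le> lam i \<and> id i = v}" for v
    using content_map_filter[of "[1..<Suc d]" id "\<lambda>i. m \<le> lam i" v] by simp
  moreover have "{i \<in> set [1..<Suc d]. m \<le> lam i \<and> id i = v} = (if m \<le> lam v then {v} else {})"
    if "v \<in> {1..d}" for v using that by auto
  ultimately have u: "content ?u v = (if m \<le> lam v then 1 else 0)" if "v \<in> {1..d}" for v
    using that by simp
  have IH: "yamanouchi d (W (Suc m))" "\<And>v. v \<in> {1..d} \<Longrightarrow> content (W (Suc m)) v = Suc (lam v) - Suc m"
    using step.IH by simp_all
  have cnt: "content (W m) v = Suc (lam v) - m" if "v \<in> {1..d}" for v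
    unfolding W content_append u[OF that] IH(2)[OF that] by (simp add: Suc_diff_le)
  have "lam (Suc k) \<le> lam k" if "1 \<le> k" "k < d" for k
    using partitions_antimono[OF lam, of k "Suc k"] that by simp
  then have "content (W m) (Suc k) \<le> content (W m) k" if "1 \<le> k" "k < d" for k
    using that by (simp add: cnt diff_le_mono)
  moreover have "sorted_wrt (<) ?u" by (rule sorted_wrt_filter[OF sorted_wrt_upt])
  ultimately have "yamanouchi d (W m)"
    unfolding W by (subst yamanouchi_append_column) (auto simp: IH)
  then show ?case using cnt by simp
qed

lemma tableau_word_yamanouchi:
  assumes "lam \<in> partitions d"
  shows "yamanouchi d (tableau_word d lam)"
  using tableau_word_suffix[OF assms, of 1] by (simp add: tableau_word_def)

lemma content_tableau_word:
  assumes "lam \<in> partitions d" "v \<in> {1..d}"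
  shows "content (tableau_word d lam) v = lam v"
  using tableau_word_suffix[OF assms(1), of 1] assms(2) by (simp add: tableau_word_def)

context skew_shape
begin

definition column_list :: "nat \<Rightarrow> (nat \<times> nat) list" where
  "column_list c = map (\<lambda>r. (r, c)) (filter (\<lambda>r. (r, c) \<in> D) (rev [1..<Suc d]))"

definition columns_before :: "nat \<Rightarrow> (nat \<times> nat) list" where
  "columns_before c = concat (map column_list [1..<c])"

definition put_bars :: "(nat \<times> nat \<Rightarrow> nat) \<Rightarrow> (nat \<times> nat) set \<Rightarrow> nat \<times> nat \<Rightarrow> entry" where
  "put_bars R S = (\<lambda>b\<in>D. if b \<in> S then Barred (R b) else Unbarred (R b))"

lemma reading_order_eq: "reading_order d mu kap = columns_before (Suc (mu 1))"
  by (simp add: reading_order_def columns_before_def column_list_def[abs_def])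

lemma set_column_list: "set (column_list c) = column c"
  by (auto simp: column_list_def column_def D_iff image_iff)

lemma distinct_column_list: "distinct (column_list c)"
  by (simp add: column_list_def distinct_map inj_on_def)

lemma columns_before_Suc: "1 \<le> c \<Longrightarrow> columns_before (Suc c) = columns_before c @ column_list c"
  by (simp add: columns_before_def)

lemma set_columns_before: "set (columns_before c) = {b \<in> D. snd b < c}"
proof -
  have "set (columns_before c) = (\<Union>e\<in>{1..<c}. column e)"
    by (simp add: columns_before_def set_column_list)
  also have "\<dots> = {b \<in> D. snd b < c}" by (auto simp: column_def D_iff)
  finally show ?thesis .
qed

lemma distinct_columns_before: "distinct (columns_before c)"
proof (induction c)
  case (Suc c)
  show ?case
  proof (cases "1 \<le> c")
    case True
    then show ?thesis using Suc
      by (auto simp: columns_before_Suc distinct_column_list set_columns_before set_column_list column_def)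
  qed (simp add: columns_before_def)
qed (simp add: columns_before_def)

lemma unbarred_entries_put_bars:
  assumes "set bs \<subseteq> D"
  shows "unbarred_entries (put_bars R S) bs = map R (filter (\<lambda>b. b \<notin> S) bs)"
  using assms by (induction bs) (auto simp: unbarred_entries_def put_bars_def is_barred_def)

lemma content_columns_before:
  "content (unbarred_entries (put_bars R S) (columns_before c)) v = count_before R S c v"
proof -
  have "set (columns_before c) \<subseteq> D" by (auto simp: set_columns_before)
  then have "content (unbarred_entries (put_bars R S) (columns_before c)) v =
      card {b \<in> set (columns_before c). b \<notin> S \<and> R b = v}"
    by (simp only: unbarred_entries_put_bars content_map_filter[OF distinct_columns_before])
  also have "{b \<in> set (columns_before c). b \<notin> S \<and> R b = v} = {b \<in> D - S. snd b < c \<and> R b = v}"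
    by (auto simp: set_columns_before)
  finally show ?thesis by (simp add: count_before_def)
qed

lemma content_unbarred_word:
  "content (unbarred_word d mu kap (put_bars R S)) = count_before R S (Suc (mu 1))"
  by (rule ext) (simp only: unbarred_word_def reading_order_eq content_columns_before)

lemma column_word_sorted:
  assumes R: "R \<in> fillings d mu kap"
  shows "sorted_wrt (<) (unbarred_entries (put_bars R S) (column_list c))"
proof -
  have "sorted_wrt (\<lambda>r r'. r' < r) (rev [1..<Suc d])"
    by (simp only: sorted_wrt_rev sorted_wrt_upt)
  then have "sorted_wrt (\<lambda>r r'. r' < r) (filter (\<lambda>r. (r, c) \<in> D) (rev [1..<Suc d]))"
    by (rule sorted_wrt_filter)
  then have "sorted_wrt (\<lambda>r r'. R (r, c) < R (r', c)) (filter (\<lambda>r. (r, c) \<in> D) (rev [1..<Suc d]))"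
    by (rule sorted_wrt_mono_rel[rotated]) (auto intro: filling_column[OF R] simp del: upt_Suc)
  then have "sorted_wrt (\<lambda>b b'. R b < R b') (column_list c)"
    by (simp only: column_list_def sorted_wrt_map)
  then have "sorted_wrt (\<lambda>b b'. R b < R b') (filter (\<lambda>b. b \<notin> S) (column_list c))"
    by (rule sorted_wrt_filter)
  moreover have "set (column_list c) \<subseteq> D" by (auto simp: set_column_list column_def)
  ultimately show ?thesis by (simp only: unbarred_entries_put_bars sorted_wrt_map)
qed

lemma unbarred_entries_append:
  "unbarred_entries B (as @ bs) = unbarred_entries B as @ unbarred_entries B bs"
  by (simp add: unbarred_entries_def)

lemma dominant_up_to_Suc:
  "dominant_up_to lam R S (Suc j) \<longleftrightarrow> dominant_up_to lam R S j \<and> (\<forall>k. 1 \<le> k \<and> k < d \<longrightarrow>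
     lam (Suc k) + count_before R S (Suc j) (Suc k) \<le> lam k + count_before R S (Suc j) k)"
  by (auto simp: dominant_up_to_def le_Suc_eq)

lemma yamanouchi_iff_dominant:
  assumes R: "R \<in> fillings d mu kap" and lam: "lam \<in> partitions d"
  shows "yamanouchi d (star_word d lam mu kap (put_bars R S)) \<longleftrightarrow> dominant_up_to lam R S (Suc (mu 1))"
proof -
  let ?word = "\<lambda>c. tableau_word d lam @ unbarred_entries (put_bars R S) (columns_before c)"
  have word: "content (?word c) v = lam v + count_before R S c v" if "v \<in> {1..d}" for c v
    using that lam by (simp add: content_append content_columns_before content_tableau_word)
  have "yamanouchi d (?word (Suc n)) \<longleftrightarrow> dominant_up_to lam R S (Suc n)" for n
  proof (induction n)
    case 0
    have "count_before R S c v = 0" if "c \<le> Suc 0" for c v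
    proof -
      have "{b \<in> D - S. snd b < c \<and> R b = v} = {}" using that by (auto simp: D_iff)
      then show ?thesis by (simp only: count_before_def card.empty)
    qed
    then have "dominant_up_to lam R S (Suc 0)"
      using lam by (auto simp: dominant_up_to_def partitions_def)
    moreover have "yamanouchi d (?word (Suc 0))"
      using tableau_word_yamanouchi[OF lam] by (simp add: columns_before_def unbarred_entries_def)
    ultimately show ?case by blast
  next
    case (Suc n)
    have w: "?word (Suc (Suc n)) = ?word (Suc n) @ unbarred_entries (put_bars R S) (column_list (Suc n))"
      by (simp add: columns_before_Suc unbarred_entries_append)
    have cond: "content (?word (Suc (Suc n))) (Suc k) \<le> content (?word (Suc (Suc n))) k \<longleftrightarrow>
        lam (Suc k) + count_before R S (Suc (Suc n)) (Suc k) \<le> lam k + count_before R S (Suc (Suc n)) k"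
      if "1 \<le> k \<and> k < d" for k
      using that by (simp add: word)
    have "yamanouchi d (?word (Suc (Suc n))) \<longleftrightarrow> yamanouchi d (?word (Suc n)) \<and>
        (\<forall>k. 1 \<le> k \<and> k < d \<longrightarrow> content (?word (Suc (Suc n))) (Suc k) \<le> content (?word (Suc (Suc n))) k)"
      unfolding w by (rule yamanouchi_append_column[OF column_word_sorted[OF R]])
    also have "\<dots> \<longleftrightarrow> dominant_up_to lam R S (Suc (Suc n))"
      unfolding dominant_up_to_Suc[of lam R S "Suc n"] Suc.IH using cond by blast
    finally show ?case .
  qed
  then show ?thesis by (simp only: star_word_def unbarred_word_def reading_order_eq)
qed

lemma content_star_word_before:
  assumes R: "R \<in> fillings d mu kap" and lam: "lam \<in> partitions d" and b: "b \<in> D"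
  shows "content (star_word_before d lam mu kap (put_bars R S) b) (R b) =
    lam (R b) + count_before R S (snd b) (R b)"
proof -
  obtain r c where rc: "b = (r, c)" by (cases b)
  have c: "1 \<le> c" "c \<le> mu 1" using b rc column_le_mu1 by (auto simp: D_iff)
  have "[1..<Suc (mu 1)] = [1..<c] @ c # [Suc c..<Suc (mu 1)]"
    using c upt_add_eq_append[of 1 c "Suc (mu 1) - c"] by (simp add: upt_conv_Cons)
  then have ro: "reading_order d mu kap =
      columns_before c @ column_list c @ concat (map column_list [Suc c..<Suc (mu 1)])"
    unfolding reading_order_eq columns_before_def by simp
  define rest where "rest = takeWhile (\<lambda>b'. b' \<noteq> b) (column_list c)"
  have "b \<in> set (column_list c)" using b rc by (simp add: set_column_list column_def)
  moreover have "b \<notin> set (columns_before c)" using rc by (simp add: set_columns_before)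
  ultimately have tw: "takeWhile (\<lambda>b'. b' \<noteq> b) (reading_order d mu kap) = columns_before c @ rest"
    unfolding ro rest_def by (subst takeWhile_append2) (auto simp: takeWhile_append1)
  have rest: "b' \<in> column c" "b' \<noteq> b" if "b' \<in> set rest" for b'
    using set_takeWhileD[OF that[unfolded rest_def]] by (simp_all add: set_column_list)
  have ne: "R b' \<noteq> R b" if "b' \<in> set rest" for b'
    using inj_onD[OF inj_on_column[OF R, of c], of b' b] rest[OF that] b rc
    by (auto simp: column_def)
  have "R b \<notin> R ` set rest"
  proof
    assume "R b \<in> R ` set rest"
    then obtain b' where "R b = R b'" "b' \<in> set rest" by (rule imageE)
    then show False using ne[of b'] by simp
  qed
  then have "R b \<notin> set (map R (filter (\<lambda>b. b \<notin> S) rest))" by auto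
  moreover have "set rest \<subseteq> D" using rest(1) by (auto simp: column_def)
  ultimately have "content (unbarred_entries (put_bars R S) rest) (R b) = 0"
    unfolding content_def by (simp only: unbarred_entries_put_bars count_notin not_False_eq_True)
  moreover have "snd b = c" by (simp add: rc)
  ultimately show ?thesis
    using filling_range[OF R b] lam
    by (simp add: star_word_before_def tw unbarred_entries_append content_append
        content_columns_before content_tableau_word)
qed

lemma star_coeff_eq:
  assumes R: "R \<in> fillings d mu kap" and lam: "lam \<in> partitions d" and S: "S \<subseteq> D"
  shows "star_coeff d lam mu kap (put_bars R S) y = (\<Prod>b\<in>S. bar_weight lam y R S b)"
proof -
  have "{b \<in> D. is_barred (put_bars R S b)} = S"
    using S by (auto simp: put_bars_def is_barred_def)
  moreover have "val (put_bars R S b) = R b" if "b \<in> S" for b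
    using that S by (auto simp: put_bars_def)
  ultimately show ?thesis
    unfolding star_coeff_def using S
    by (auto simp: Let_def bar_weight_def case_prod_beta content_star_word_before[OF R lam] subset_iff
        intro!: prod.cong)
qed

lemma sum_yamanouchi_fillings:
  assumes lam: "lam \<in> partitions d"
  shows "(\<Sum>B\<in>{B \<in> barred_fillings d mu kap. yamanouchi d (star_word d lam mu kap B)}. f B) =
    (\<Sum>(R, S)\<in>hybrids lam (Suc (mu 1)). f (put_bars R S))"
proof (rule sum.reindex_bij_witness[where i = "\<lambda>p. put_bars (fst p) (snd p)" and
      j = "\<lambda>B. (\<lambda>b\<in>D. val (B b), {b \<in> D. is_barred (B b)})"])
  fix B assume B: "B \<in> {B \<in> barred_fillings d mu kap. yamanouchi d (star_word d lam mu kap B)}"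
  let ?R = "\<lambda>b\<in>D. val (B b)" and ?S = "{b \<in> D. is_barred (B b)}"
  have mem: "B b \<in> Unbarred ` {1..d} \<union> Barred ` {1..d}" if "b \<in> D" for b
    using B that unfolding barred_fillings_def by blast
  have und: "B b = undefined" if "b \<notin> D" for b
    using B that PiE_arb unfolding barred_fillings_def by blast
  have eq: "put_bars ?R ?S = B"
  proof
    fix b
    show "put_bars ?R ?S b = B b"
      using mem[of b] und[of b] by (auto simp: put_bars_def is_barred_def)
  qed
  then show "put_bars (fst (?R, ?S)) (snd (?R, ?S)) = B" by simp
  have "semistandard D (\<lambda>b. val (B b))" using B by (simp add: barred_fillings_def)
  then have "semistandard D ?R" by (simp add: semistandard_def)
  moreover have "?R \<in> D \<rightarrow>\<^sub>E {1..d}" using mem by fastforce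
  ultimately have R: "?R \<in> fillings d mu kap" by (simp add: fillings_def)
  have "dominant_up_to lam ?R ?S (Suc (mu 1))"
    using B yamanouchi_iff_dominant[OF R lam, of ?S] by (simp add: eq)
  moreover have "?S \<subseteq> {b \<in> D. snd b < Suc (mu 1)}"
    using column_le_mu1 by (fastforce simp: less_Suc_eq_le)
  ultimately show "(?R, ?S) \<in> hybrids lam (Suc (mu 1))" using R by (simp add: hybrids_def)
  show "(case (?R, ?S) of (R, S) \<Rightarrow> f (put_bars R S)) = f B" by (simp add: eq)
next
  fix p assume p: "p \<in> hybrids lam (Suc (mu 1))"
  obtain R S where RS: "p = (R, S)" by (cases p)
  have R: "R \<in> fillings d mu kap" and S: "S \<subseteq> D" and dom: "dominant_up_to lam R S (Suc (mu 1))"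
    using p by (auto simp: hybrids_def RS)
  let ?B = "put_bars R S"
  have val: "val (?B b) = R b" if "b \<in> D" for b using that by (simp add: put_bars_def)
  have "{b \<in> D. is_barred (?B b)} = S" using S by (auto simp: put_bars_def is_barred_def)
  moreover have "(\<lambda>b\<in>D. val (?B b)) = R"
    using filling_outside[OF R] by (auto simp: fun_eq_iff val)
  ultimately show "(\<lambda>b\<in>D. val (put_bars (fst p) (snd p) b), {b \<in> D. is_barred (put_bars (fst p) (snd p) b)}) = p"
    by (simp add: RS)
  have "semistandard D R" using R by (simp add: fillings_def)
  then have "semistandard D (\<lambda>b. val (?B b))" by (simp add: semistandard_def val)
  moreover have "?B \<in> D \<rightarrow>\<^sub>E Unbarred ` {1..d} \<union> Barred ` {1..d}"
    using filling_range[OF R] by (auto simp: put_bars_def)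
  ultimately have "?B \<in> barred_fillings d mu kap" by (simp add: barred_fillings_def)
  then show "put_bars (fst p) (snd p) \<in>
      {B \<in> barred_fillings d mu kap. yamanouchi d (star_word d lam mu kap B)}"
    using dom yamanouchi_iff_dominant[OF R lam, of S] by (simp add: RS)
qed

end

section \<open>Cancelling the alternant\<close>

text \<open>
  The theorem is known up to the factor \<open>alternant d empty_partition y x\<close>, a Vandermonde determinant, which
  may be a zero divisor. The remedy is to prove the identity over the polynomials in \<open>t\<close> for the
  perturbed variables \<open>x\<^sub>i + t\<^bsup>d + 1 - i\<^esup>\<close>, where this factor is monic and can be cancelled over any
  ring, and then to set \<open>t = 0\<close>.
\<close>

definition monic_of_degree :: "nat \<Rightarrow> 'a :: comm_ring_1 poly \<Rightarrow> bool" where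
  "monic_of_degree n p \<longleftrightarrow> degree p \<le> n \<and> coeff p n = 1"

lemma monic_of_degree_mult:
  assumes "monic_of_degree m p" "monic_of_degree n q"
  shows "monic_of_degree (m + n) (p * q)"
proof -
  have deg: "degree p = m" "degree q = n"
    using assms le_degree[of p m] le_degree[of q n] by (auto simp: monic_of_degree_def)
  then show ?thesis
    using assms coeff_mult_degree_sum[of p q] degree_mult_le[of p q] by (simp add: monic_of_degree_def)
qed

lemma monic_of_degree_prod:
  assumes "finite I" "\<And>i. i \<in> I \<Longrightarrow> monic_of_degree (n i) (f i)"
  shows "monic_of_degree (\<Sum>i\<in>I. n i) (\<Prod>i\<in>I. f i)"
  using assms
proof (induction I rule: finite_induct)
  case empty
  then show ?case by (simp add: monic_of_degree_def)
qed (simp add: monic_of_degree_mult)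

lemma monic_of_degree_cancel:
  assumes p: "monic_of_degree n p" and eq: "p * q = p * r"
  shows "q = r"
proof (rule ccontr)
  assume "q \<noteq> r"
  define s where "s = q - r"
  have "coeff (p * s) (degree p + degree s) = coeff p (degree p) * coeff s (degree s)"
    by (rule coeff_mult_degree_sum)
  moreover have "degree p = n" using p le_degree[of p n] by (auto simp: monic_of_degree_def)
  moreover have "p * s = 0" using eq by (simp add: s_def algebra_simps)
  ultimately have "s = 0" using p by (simp add: monic_of_degree_def)
  with \<open>q \<noteq> r\<close> show False by (simp add: s_def)
qed

text \<open>
  The equality case of the rearrangement inequality.
\<close>

lemma sum_prod_permute_less:
  fixes a :: "nat \<Rightarrow> int"
  assumes p: "p permutes I" and fin: "finite I" and ne: "\<exists>i\<in>I. a (p i) \<noteq> a i"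
  shows "(\<Sum>i\<in>I. a i * a (p i)) < (\<Sum>i\<in>I. a i * a i)"
proof -
  obtain i where "i \<in> I" "a (p i) \<noteq> a i" using ne by blast
  then have "0 < (\<Sum>i\<in>I. (a i - a (p i)) ^ 2)"
    by (intro sum_pos2[OF fin, of i]) auto
  also have "\<dots> = (\<Sum>i\<in>I. a i * a i) + (\<Sum>i\<in>I. a (p i) * a (p i)) - 2 * (\<Sum>i\<in>I. a i * a (p i))"
    by (simp add: power2_eq_square algebra_simps sum.distrib sum_subtractf sum_distrib_left)
  also have "(\<Sum>i\<in>I. a (p i) * a (p i)) = (\<Sum>i\<in>I. a i * a i)"
    using sum.permute[OF p, of "\<lambda>i. a i * a i"] by (simp add: o_def)
  finally show ?thesis by simp
qed

text \<open>
  The exponent is positive even for \<open>i = d\<close>, so that \<open>t = 0\<close> gives back \<open>x\<close>.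
\<close>

definition generic_point :: "nat \<Rightarrow> (nat \<Rightarrow> 'a) \<Rightarrow> nat \<Rightarrow> 'a :: comm_ring_1 poly" where
  "generic_point d x i = [:x i:] + monom 1 (Suc (d - i))"

text \<open>
  The summand of a permutation \<open>p\<close> has degree \<open>\<Sum>(d - i) (d - p i + 1)\<close> in \<open>t\<close>, which is largest for the
  identity and only for it.
\<close>

lemma alternant_generic_monic:
  fixes x :: "nat \<Rightarrow> 'a :: comm_ring_1"
  shows "\<exists>n. monic_of_degree n (alternant d empty_partition (\<lambda>m. [:y m:]) (generic_point d x))"
proof -
  let ?Y = "\<lambda>m. [:y m:]" and ?X = "generic_point d x"
  define E where "E p = (\<Sum>i\<in>{1..d}. \<Sum>m\<in>{1..d - i}. Suc (d - p i))" for p :: "nat \<Rightarrow> nat"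
  define T where "T p = factorial_monomial d (\<lambda>i. empty_partition i + (d - i)) ?Y (?X \<circ> p)" for p
  have linear: "monic_of_degree (Suc (d - i)) (?X i - [:c:])" for i c
  proof -
    have eq: "?X i - [:c:] = [:x i - c:] + monom 1 (Suc (d - i))"
      by (simp add: generic_point_def)
    have "degree (monom (1 :: 'a) (Suc (d - i))) \<le> Suc (d - i)" by (rule degree_monom_le)
    then show ?thesis
      unfolding eq monic_of_degree_def by (auto intro!: degree_add_le simp: coeff_pCons)
  qed
  have T: "monic_of_degree (E p) (T p)" for p
    unfolding E_def T_def factorial_monomial_def empty_partition_apply add_0 o_apply
    by (intro monic_of_degree_prod finite_atLeastAtMost linear)
  have less: "E p < E id" if p: "p permutes {1..d}" and ne: "p \<noteq> id" for p
  proof -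
    define a where "a i = int d - int i" for i
    have E: "int (E q) = (\<Sum>i\<in>{1..d}. a i) + (\<Sum>i\<in>{1..d}. a i * a (q i))"
      if q: "q permutes {1..d}" for q
    proof -
      have "q i \<le> d" if "i \<in> {1..d}" for i using permutes_in_image[OF q, of i] that by simp
      then have "int (E q) = (\<Sum>i\<in>{1..d}. a i * (a (q i) + 1))"
        unfolding E_def of_nat_sum by (intro sum.cong) (auto simp: a_def of_nat_diff algebra_simps)
      then show ?thesis by (simp add: algebra_simps sum.distrib)
    qed
    have "\<exists>i\<in>{1..d}. a (p i) \<noteq> a i"
    proof (rule ccontr)
      assume "\<not> (\<exists>i\<in>{1..d}. a (p i) \<noteq> a i)"
      then have "p i = i" if "i \<in> {1..d}" for i using that by (auto simp: a_def)
      then have "p = id" using permutes_not_in[OF p] by (metis eq_id_iff)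
      with ne show False by simp
    qed
    from sum_prod_permute_less[OF p _ this] have "int (E p) < int (E id)"
      unfolding E[OF p] E[OF permutes_id] by simp
    then show ?thesis by simp
  qed
  let ?P = "{p. p permutes {1..d}}"
  have alt: "alternant d empty_partition ?Y ?X = (\<Sum>p\<in>?P. of_int (sign p) * T p)"
    by (simp add: alternant_def alternate_def T_def)
  have coeff_int: "coeff (of_int s * q) n = of_int s * coeff q n" for s n and q :: "'a poly"
    by (simp add: of_int_poly)
  have deg: "degree (of_int (sign p) * T p) \<le> E p" for p
    using T[of p] by (intro degree_le) (auto simp: coeff_int monic_of_degree_def coeff_eq_0)
  have fin: "finite ?P" by (simp add: finite_permutations)
  have "degree (alternant d empty_partition ?Y ?X) \<le> E id"
    unfolding alt
  proof (rule degree_sum_le[OF fin])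
    fix p assume p: "p \<in> ?P"
    then have "E p \<le> E id" using less[of p] by (cases "p = id") auto
    then show "degree (of_int (sign p) * T p) \<le> E id" using deg[of p] by simp
  qed
  moreover have "coeff (alternant d empty_partition ?Y ?X) (E id) = 1"
  proof -
    have "coeff (of_int (sign p) * T p) (E id) = (if p = id then 1 else 0)" if "p \<in> ?P" for p
    proof (cases "p = id")
      case True
      then show ?thesis using T[of id] by (simp add: coeff_int monic_of_degree_def)
    next
      case False
      then show ?thesis using less[of p] deg[of p] that by (simp add: coeff_eq_0)
    qed
    then have "coeff (alternant d empty_partition ?Y ?X) (E id) = (\<Sum>p\<in>?P. if p = id then 1 else 0)"
      unfolding alt coeff_sum by (rule sum.cong[OF refl])
    also have "\<dots> = 1" using fin permutes_id[of "{1..d}"] by simp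
    finally show ?thesis .
  qed
  ultimately show ?thesis unfolding monic_of_degree_def by blast
qed

lemma poly_skew_factorial_schur:
  "poly (skew_factorial_schur d mu kap (generic_point d x) (\<lambda>m. [:y m:])) 0 =
    skew_factorial_schur d mu kap x y"
  unfolding skew_factorial_schur_def
  by (simp add: poly_sum poly_prod case_prod_beta generic_point_def poly_monom)

lemma poly_star_coeff:
  "poly (star_coeff d lam mu kap B (\<lambda>m. [:y m:])) 0 = star_coeff d lam mu kap B y"
  unfolding star_coeff_def by (simp add: poly_prod case_prod_beta Let_def)

lemma alternant_times_product:
  fixes x :: "nat \<Rightarrow> 'a :: comm_ring_1"
  assumes lam: "lam \<in> partitions d" and mu: "mu \<in> partitions d" and kap: "kap \<in> partitions d"
  shows "alternant d empty_partition y x * (factorial_schur d lam x y * skew_factorial_schur d mu kap x y) =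
    alternant d empty_partition y x *
    (\<Sum>B \<in> {B \<in> barred_fillings d mu kap. yamanouchi d (star_word d lam mu kap B)}.
       star_coeff d lam mu kap B y *
       factorial_schur d (\<lambda>i. lam i + content (unbarred_word d mu kap B) i) x y)"
proof -
  interpret skew_shape d mu kap by standard (fact mu, fact kap)
  let ?a = "alternant d empty_partition y x" and ?N = "Suc (mu 1)"
  have summand: "(\<Prod>b\<in>S. bar_weight lam y R S b) * alternant d (\<lambda>i. lam i + count_before R S ?N i) y x =
      ?a * (star_coeff d lam mu kap (put_bars R S) y *
        factorial_schur d (\<lambda>i. lam i + content (unbarred_word d mu kap (put_bars R S)) i) x y)"
    if RS: "(R, S) \<in> hybrids lam ?N" for R S
  proof -
    have R: "R \<in> fillings d mu kap" and S: "S \<subseteq> D" and dom: "dominant_up_to lam R S ?N"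
      using RS by (auto simp: hybrids_def)
    have "count_before R S ?N i = 0" if "i \<notin> {1..d}" for i
    proof -
      have "{b \<in> D - S. snd b < ?N \<and> R b = i} = {}" using filling_range[OF R] that by blast
      then show ?thesis by (simp only: count_before_def card.empty)
    qed
    then have "(\<lambda>i. lam i + count_before R S ?N i) \<in> partitions d"
      using lam dom by (auto simp: partitions_def dominant_up_to_def)
    from alternant_eq[OF this, of y x] show ?thesis
      by (simp only: star_coeff_eq[OF R lam S] content_unbarred_word mult.left_commute)
  qed
  have "?a * (factorial_schur d lam x y * skew_factorial_schur d mu kap x y) =
      alternant d lam y x * skew_factorial_schur d mu kap x y"
    by (simp add: alternant_eq[OF lam] mult.assoc)
  also have "\<dots> = (\<Sum>(R, S)\<in>hybrids lam ?N. (\<Prod>b\<in>S. bar_weight lam y R S b) *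
       alternant d (\<lambda>i. lam i + count_before R S ?N i) y x)"
    by (rule alternant_times_skew_factorial_schur[OF lam])
  also have "\<dots> = (\<Sum>(R, S)\<in>hybrids lam ?N. ?a * (star_coeff d lam mu kap (put_bars R S) y *
        factorial_schur d (\<lambda>i. lam i + content (unbarred_word d mu kap (put_bars R S)) i) x y))"
    by (rule sum.cong[OF refl]) (simp only: split_paired_all prod.case summand)
  finally show ?thesis
    unfolding sum_yamanouchi_fillings[OF lam] by (simp add: sum_distrib_left case_prod_beta)
qed

theorem mainTheorem7:
  fixes d :: nat
    and lam mu kap :: "nat \<Rightarrow> nat"
    and x :: "nat \<Rightarrow> 'a :: comm_ring_1"
    and y :: "int \<Rightarrow> 'a"
  assumes "d \<ge> 1"
    and "lam \<in> partitions d" and "mu \<in> partitions d" and "kap \<in> partitions d"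
    and "\<forall>i \<in> {1..d}. kap i \<le> mu i"
  shows "factorial_schur d lam x y * skew_factorial_schur d mu kap x y =
    (\<Sum>B \<in> {B \<in> barred_fillings d mu kap. yamanouchi d (star_word d lam mu kap B)}.
       star_coeff d lam mu kap B y *
       factorial_schur d (\<lambda>i. lam i + content (unbarred_word d mu kap B) i) x y)"
proof -
  let ?X = "generic_point d x" and ?Y = "\<lambda>m. [:y m:]"
  obtain n where "monic_of_degree n (alternant d empty_partition ?Y ?X)"
    using alternant_generic_monic by blast
  from monic_of_degree_cancel[OF this alternant_times_product[OF assms(2-4)]]
  have "factorial_schur d lam ?X ?Y * skew_factorial_schur d mu kap ?X ?Y =
    (\<Sum>B \<in> {B \<in> barred_fillings d mu kap. yamanouchi d (star_word d lam mu kap B)}.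
       star_coeff d lam mu kap B ?Y *
       factorial_schur d (\<lambda>i. lam i + content (unbarred_word d mu kap B) i) ?X ?Y)" .
  from arg_cong[OF this, of "\<lambda>p. poly p 0"] show ?thesis
    by (simp only: factorial_schur_def poly_mult poly_sum poly_skew_factorial_schur poly_star_coeff)
qed

end
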